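(* Let $\alpha_0,\dots,\alpha_4\in\mathbb{C}$ with $\alpha_0+\alpha_1+\alpha_2+\alpha_3+\alpha_4=1$. The $A_4^{(1)}$ Painlevé equation $A_4(\alpha_0,\alpha_1,\alpha_2,\alpha_3,\alpha_4)$ has a rational solution if and only if the parameters satisfy one of the following three conditions; moreover, if a rational solution exists, it is unique. (1) $\alpha_0,\alpha_1,\dots,\alpha_4\in\mathbb{Z}$. (2) For some $i\in\{0,1,2,3,4\}$ (indices modulo $5$), $(\alpha_i,\alpha_{i+1},\alpha_{i+2},\alpha_{i+3},\alpha_{i+4})\equiv \pm\frac13(1,1,1,0,0)$ or $\equiv \pm\frac13(1,-1,-1,1,0)$ modulo $\mathbb{Z}$ (componentwise). (3) For some $i\in\{0,1,2,3,4\}$ and some $j\in\{1,2,3,4\}$, $(\alpha_i,\alpha_{i+1},\alpha_{i+2},\alpha_{i+3},\alpha_{i+4})\equiv \frac j5(1,1,1,1,1)$ or $\equiv \frac j5(1,2,1,3,3)$ modulo $\mathbb{Z}$ (componentwise). (4) Furthermore, by a suitable Bäcklund transformation, the rational solution in class (1), (2), (3) is respectively transformed into: (i) $(f_0,f_1,f_2,f_3,f_4)=(t,0,0,0,0)$ with $(\alpha_0,\dots,\alpha_4)=(1,0,0,0,0)$; (ii) $(f_0,f_1,f_2,f_3,f_4)=(\frac t3,\frac t3,\frac t3,0,0)$ with $(\alpha_0,\dots,\alpha_4)=(\frac13,\frac13,\frac13,0,0)$; (iii) $(f_0,f_1,f_2,f_3,f_4)=(\frac t5,\frac t5,\frac t5,\frac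 t5,\frac t5)$ with $(\alpha_0,\dots,\alpha_4)=(\frac15,\frac15,\frac15,\frac15,\frac15)$.
   Context: The $A_4^{(1)}$ Painlevé equation $A_4(\alpha_0,\dots,\alpha_4)$ with complex parameters $\alpha_j$ is the system for five functions $f_0,\dots,f_4$ of the complex variable $t$ (indices of $f_j$ and $\alpha_j$ taken in $\mathbb{Z}/5\mathbb{Z}$, ${}'=d/dt$): $f_j'=f_j(f_{j+1}-f_{j+2}+f_{j+3}-f_{j+4})+\alpha_j$ for $j=0,\dots,4$, together with $f_0+f_1+f_2+f_3+f_4=t$; this forces $\sum_j\alpha_j=1$. A rational solution is a tuple $(f_0,\dots,f_4)$ of rational functions of $t$ satisfying the system. Bäcklund transformations: the group generated by $s_0,\dots,s_4,\pi$, acting on (solution, parameters) by: $s_i(f_i)=f_i$, $s_i(f_{i+1})=f_{i+1}+\alpha_i/f_i$, $s_i(f_{i-1})=f_{i-1}-\alpha_i/f_i$, $s_i(f_k)=f_k$ for $k\neq i,i\pm1$; $s_i(\alpha_i)=-\alpha_i$, $s_i(\alpha_{i\pm1})=\alpha_{i\pm1}+\alpha_i$, $s_i(\alpha_k)=\alpha_k$ otherwise; $\pi(f_j)=f_{j+1}$, $\pi(\alpha_j)=\alpha_{j+1}$. If $f_i\equiv0$, $s_i$ is taken to be the identity. These map solutions of $A_4(\alpha)$ to solutions of the equation with transformed parameters. *)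

theory Defs
  imports Complex_Main "HOL-Library.Numeral_Type" "HOL-Computational_Algebra.Polynomial"
begin

text \<open>Indices live in the numeral type 5 = Z/5Z, so index arithmetic wraps around.
  A rational function of t is represented by a function on the complex plane that
  agrees with p/q wherever q does not vanish; two such functions are identified when
  they agree outside a finite set.\<close>

definition rational_fun :: "(complex \<Rightarrow> complex) \<Rightarrow> bool" where
  "rational_fun h \<longleftrightarrow> (\<exists>p q. q \<noteq> 0 \<and> (\<forall>z. poly q z \<noteq> 0 \<longrightarrow> h z = poly p z / poly q z))"

definition A4_rhs :: "(5 \<Rightarrow> complex) \<Rightarrow> (5 \<Rightarrow> complex \<Rightarrow> complex) \<Rightarrow> 5 \<Rightarrow> complex \<Rightarrow> complex" where
  "A4_rhs \<alpha> f j t =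
     f j t * (f (j+1) t - f (j+2) t + f (j+3) t - f (j+4) t) + \<alpha> j"

text \<open>A rational solution of A4(alpha): rational functions satisfying the system
  (for all t outside a finite set, i.e. as identities of rational functions).\<close>
definition rat_solution :: "(5 \<Rightarrow> complex) \<Rightarrow> (5 \<Rightarrow> complex \<Rightarrow> complex) \<Rightarrow> bool" where
  "rat_solution \<alpha> f \<longleftrightarrow>
     (\<forall>j. rational_fun (f j)) \<and>
     (\<forall>\<^sub>F t in cofinite. (\<Sum>j\<in>UNIV. f j t) = t \<and>
        (\<forall>j. (f j has_field_derivative A4_rhs \<alpha> f j t) (at t)))"

definition same_ratfun :: "(5 \<Rightarrow> complex \<Rightarrow> complex) \<Rightarrow> (5 \<Rightarrow> complex \<Rightarrow> complex) \<Rightarrow> bool" where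
  "same_ratfun f g \<longleftrightarrow> (\<forall>j. \<forall>\<^sub>F t in cofinite. f j t = g j t)"

definition shift_cong :: "(5 \<Rightarrow> complex) \<Rightarrow> 5 \<Rightarrow> complex \<Rightarrow> complex list \<Rightarrow> bool" where
  "shift_cong \<alpha> i c v \<longleftrightarrow> (\<forall>k<5. \<alpha> (i + of_nat k) - c * v ! k \<in> \<int>)"

definition cond1 :: "(5 \<Rightarrow> complex) \<Rightarrow> bool" where
  "cond1 \<alpha> \<longleftrightarrow> (\<forall>j. \<alpha> j \<in> \<int>)"

definition cond2 :: "(5 \<Rightarrow> complex) \<Rightarrow> bool" where
  "cond2 \<alpha> \<longleftrightarrow> (\<exists>i. \<exists>c\<in>{1/3, -1/3}.
      shift_cong \<alpha> i c [1,1,1,0,0] \<or> shift_cong \<alpha> i c [1,-1,-1,1,0])"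

definition cond3 :: "(5 \<Rightarrow> complex) \<Rightarrow> bool" where
  "cond3 \<alpha> \<longleftrightarrow> (\<exists>i. \<exists>j::nat\<in>{1..4}.
      shift_cong \<alpha> i (of_nat j / 5) [1,1,1,1,1] \<or> shift_cong \<alpha> i (of_nat j / 5) [1,2,1,3,3])"

datatype gen = S 5 | Pi

fun bt_act :: "gen \<Rightarrow> (5 \<Rightarrow> complex) \<times> (5 \<Rightarrow> complex \<Rightarrow> complex)
                   \<Rightarrow> (5 \<Rightarrow> complex) \<times> (5 \<Rightarrow> complex \<Rightarrow> complex)" where
  "bt_act (S i) (\<alpha>, f) =
     (if (\<forall>\<^sub>F t in cofinite. f i t = 0) then (\<alpha>, f)
      else ((\<lambda>k. if k = i then - \<alpha> i
                 else if k = i + 1 \<or> k = i - 1 then \<alpha> k + \<alpha> i else \<alpha> k),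
            (\<lambda>k t. if k = i + 1 then f k t + \<alpha> i / f i t
                   else if k = i - 1 then f k t - \<alpha> i / f i t else f k t)))"
| "bt_act Pi (\<alpha>, f) = ((\<lambda>j. \<alpha> (j + 1)), (\<lambda>j. f (j + 1)))"

definition bt_word :: "gen list \<Rightarrow> (5 \<Rightarrow> complex) \<times> (5 \<Rightarrow> complex \<Rightarrow> complex)
                   \<Rightarrow> (5 \<Rightarrow> complex) \<times> (5 \<Rightarrow> complex \<Rightarrow> complex)" where
  "bt_word ws p = fold bt_act ws p"

definition bt_reaches :: "(5 \<Rightarrow> complex) \<Rightarrow> (5 \<Rightarrow> complex \<Rightarrow> complex)
      \<Rightarrow> (5 \<Rightarrow> complex) \<Rightarrow> (5 \<Rightarrow> complex \<Rightarrow> complex) \<Rightarrow> bool" where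
  "bt_reaches \<alpha> f \<beta> g \<longleftrightarrow>
     (\<exists>ws. fst (bt_word ws (\<alpha>, f)) = \<beta> \<and> same_ratfun (snd (bt_word ws (\<alpha>, f))) g)"

end

theory Submission
  imports Defs "HOL-Complex_Analysis.Laurent_Convergence"
    "HOL-Computational_Algebra.Fundamental_Theorem_Algebra"
begin

text \<open>
  All poles of a rational solution are simple, with integer residue vectors, up to rotation,
  $(1,-1,0,0,0)$, $(-1,0,1,0,0)$ or $(3,1,-1,-3,0)$. At infinity $f_j = a_j t + b_j/t + \dots$, where
  $a$ is a rotation of $(1,0,0,0,0)$, $\frac13(1,1,1,0,0)$, $(1,1,0,-1,0)$ or $\frac15(1,1,1,1,1)$.
  Since $b_j$ is a sum of residues, it is an integer, which forces $15\alpha_j \in \mathbb{Z}$.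
  The five Hamiltonians have nonnegative residues at all poles, so their coefficients
  of $1/t$ at infinity, which are explicit quadratic expressions in $b$ and $\alpha$, are nonnegative.
  If all $\alpha_j \ge 0$ (the closed fundamental alcove), the average of these coefficients with
  weights $\alpha_j$ turns out to be nonpositive for each of the four types of $a$; so it vanishes, and
  then the individual inequalities force $a = \alpha$ and $b = 0$. Hence there are no poles and
  $f_j = \alpha_j t$.

  For general parameters, applying $s_i$ whenever $\alpha_i < 0$ reaches the alcove after finitely many
  steps, because $15\alpha$ is an integer vector and its distance to the barycentre of the alcove drops.
  In this way existence, uniqueness and the normal forms are all reduced to the alcove.
\<close>

unbundle no vec_syntax and fps_syntax

section \<open>Indices modulo 5\<close>

text \<open>The asymptotic type alone cannot single out the normal forms: (1,1,0,-1,0) t is itself a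
  rational solution, with parameters (1,1,0,-1,0). Only the signs of the parameters exclude this
  type, which is why the residue argument is carried out in the alcove. The weights \<alpha>_J are
  no guess: in the weighted sum of the linear parts, the coefficient of each b_m is an antisymmetric
  bilinear form evaluated at (\<alpha>, \<alpha>). So only the quadratic part survives, and
  nonnegative weights preserve the inequality. Every reflection is applied with \<alpha>_i nonzero.
  Then f_i cannot vanish identically, so s_i is never the identity by convention, and it can be
  undone. Statements about solutions are therefore carried back along the descent, once the three
  conditions are known to be stable under reflections; this is a finite check modulo 3 and modulo 5.
  The number 15 is a common denominator of the four types of a.\<close>

lemma index5_cases: "(x::5) = 0 \<or> x = 1 \<or> x = 2 \<or> x = 3 \<or> x = 4"
proof -
  obtain z where "x = of_int z" "0 \<le> z" "z < 5" by (cases x) auto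
  then have "z \<in> {0,1,2,3,4}" by auto
  then show ?thesis using \<open>x = of_int z\<close> by auto
qed

lemma UNIV5: "(UNIV :: 5 set) = {0,1,2,3,4}"
  by (intro set_eqI) (simp add: index5_cases)

lemma all5: "(\<forall>j::5. P j) \<longleftrightarrow> P 0 \<and> P 1 \<and> P 2 \<and> P 3 \<and> P 4"
proof -
  have "(\<forall>j::5. P j) \<longleftrightarrow> (\<forall>j\<in>UNIV. P j)" by simp
  then show ?thesis unfolding UNIV5 by simp
qed

lemma sum5: "(\<Sum>j\<in>(UNIV::5 set). g j) = g 0 + g 1 + g 2 + g 3 + g 4"
  unfolding UNIV5 by (simp add: add.assoc)

lemma num5 [simp]: "(5::5) = 0" "(6::5) = 1" "(7::5) = 2" "(8::5) = 3"
  by simp_all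

text \<open>The system reads f_j' = f_j \<open>alt\<close> f j + \<alpha>_j. Polymorphic, since the
  same expression is needed for numbers, Laurent series and power series.\<close>

definition alt :: "(5 \<Rightarrow> 'a::ab_group_add) \<Rightarrow> 5 \<Rightarrow> 'a" where
  "alt x j = x (j+1) - x (j+2) + x (j+3) - x (j+4)"

lemma ex5: "(\<exists>j::5. P j) \<longleftrightarrow> P 0 \<or> P 1 \<or> P 2 \<or> P 3 \<or> P 4"
  using all5[of "\<lambda>j. \<not> P j"] by blast

text \<open>There are eight binary necklaces with five beads. Applied to the support of a vector,
  this leaves 8 of 32 cases.\<close>

lemma bool_pattern_rotation:
  fixes P :: "5 \<Rightarrow> bool"
  shows "\<exists>i. (P i, P (i+1), P (i+2), P (i+3), P (i+4)) \<in>
    {(False,False,False,False,False), (True,False,False,False,False),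
     (True,True,False,False,False), (True,False,True,False,False),
     (True,True,True,False,False), (True,True,False,True,False),
     (True,True,True,True,False), (True,True,True,True,True)}"
  unfolding ex5 by (cases "P 0"; cases "P 1"; cases "P 2"; cases "P 3"; cases "P 4") simp_all

lemma alt_shift: "alt (\<lambda>k. x (i + k)) j = alt x (i + j)"
  by (simp add: alt_def add.assoc)

lemma sum_shift5: "(\<Sum>j\<in>UNIV. g (i + j)) = (\<Sum>j\<in>(UNIV::5 set). g j)"
  by (rule sum.reindex_bij_witness[of _ "\<lambda>j. j - i" "\<lambda>j. i + j"]) auto

section \<open>Quadratic systems for leading coefficients and residues\<close>

text \<open>The hypothesis is the comparison of double poles on both sides of the system. On a fixed
  support the factor \<open>r j\<close> cancels and the equations become linear.\<close>

lemma residue_vector: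
  fixes r :: "5 \<Rightarrow> complex"
  assumes eq: "\<And>j. r j * alt r j = - r j" and sum: "(\<Sum>j\<in>UNIV. r j) = 0"
  shows "\<exists>i. (r i, r (i+1), r (i+2), r (i+3), r (i+4)) \<in>
    {(0,0,0,0,0), (1,-1,0,0,0), (-1,0,1,0,0), (3,1,-1,-3,0)}"
proof -
  obtain i where i: "(r i \<noteq> 0, r (i+1) \<noteq> 0, r (i+2) \<noteq> 0, r (i+3) \<noteq> 0, r (i+4) \<noteq> 0) \<in>
    {(False,False,False,False,False), (True,False,False,False,False),
     (True,True,False,False,False), (True,False,True,False,False),
     (True,True,True,False,False), (True,True,False,True,False),
     (True,True,True,True,False), (True,True,True,True,True)}"
    using bool_pattern_rotation[of "\<lambda>j. r j \<noteq> 0"] by blast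
  define x0 x1 x2 x3 x4 where x: "x0 = r i" "x1 = r (i+1)" "x2 = r (i+2)" "x3 = r (i+3)" "x4 = r (i+4)"
  have "x0 + x1 + x2 + x3 + x4 = 0"
    using sum sum_shift5[of r i] by (simp add: sum5 x)
  moreover have "x0 \<noteq> 0 \<Longrightarrow> x1 - x2 + x3 - x4 = -1"
    using eq[of i] mult_cancel_left[of x0 "alt r i" "-1"] by (simp add: alt_def x add.assoc)
  moreover have "x1 \<noteq> 0 \<Longrightarrow> x2 - x3 + x4 - x0 = -1"
    using eq[of "i+1"] mult_cancel_left[of x1 "alt r (i+1)" "-1"] by (simp add: alt_def x add.assoc)
  moreover have "x2 \<noteq> 0 \<Longrightarrow> x3 - x4 + x0 - x1 = -1"
    using eq[of "i+2"] mult_cancel_left[of x2 "alt r (i+2)" "-1"] by (simp add: alt_def x add.assoc)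
  moreover have "x3 \<noteq> 0 \<Longrightarrow> x4 - x0 + x1 - x2 = -1"
    using eq[of "i+3"] mult_cancel_left[of x3 "alt r (i+3)" "-1"] by (simp add: alt_def x add.assoc)
  moreover have "x4 \<noteq> 0 \<Longrightarrow> x0 - x1 + x2 - x3 = -1"
    using eq[of "i+4"] mult_cancel_left[of x4 "alt r (i+4)" "-1"] by (simp add: alt_def x add.assoc)
  ultimately have "(x0,x1,x2,x3,x4) \<in> {(0,0,0,0,0), (1,-1,0,0,0), (-1,0,1,0,0), (3,1,-1,-3,0)}"
    if "(x0 \<noteq> 0, x1 \<noteq> 0, x2 \<noteq> 0, x3 \<noteq> 0, x4 \<noteq> 0) \<in>
    {(False,False,False,False,False), (True,False,False,False,False),
     (True,True,False,False,False), (True,False,True,False,False),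
     (True,True,True,False,False), (True,True,False,True,False),
     (True,True,True,True,False), (True,True,True,True,True)}"
  proof -
    assume s: "x0 + x1 + x2 + x3 + x4 = 0"
      and e: "x0 \<noteq> 0 \<Longrightarrow> x1 - x2 + x3 - x4 = -1" "x1 \<noteq> 0 \<Longrightarrow> x2 - x3 + x4 - x0 = -1"
        "x2 \<noteq> 0 \<Longrightarrow> x3 - x4 + x0 - x1 = -1" "x3 \<noteq> 0 \<Longrightarrow> x4 - x0 + x1 - x2 = -1"
        "x4 \<noteq> 0 \<Longrightarrow> x0 - x1 + x2 - x3 = -1"
    from that consider
        "x0 = 0" "x1 = 0" "x2 = 0" "x3 = 0" "x4 = 0"
      | "x0 \<noteq> 0" "x1 = 0" "x2 = 0" "x3 = 0" "x4 = 0"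
      | "x0 \<noteq> 0" "x1 \<noteq> 0" "x2 = 0" "x3 = 0" "x4 = 0"
      | "x0 \<noteq> 0" "x1 = 0" "x2 \<noteq> 0" "x3 = 0" "x4 = 0"
      | "x0 \<noteq> 0" "x1 \<noteq> 0" "x2 \<noteq> 0" "x3 = 0" "x4 = 0"
      | "x0 \<noteq> 0" "x1 \<noteq> 0" "x2 = 0" "x3 \<noteq> 0" "x4 = 0"
      | "x0 \<noteq> 0" "x1 \<noteq> 0" "x2 \<noteq> 0" "x3 \<noteq> 0" "x4 = 0"
      | "x0 \<noteq> 0" "x1 \<noteq> 0" "x2 \<noteq> 0" "x3 \<noteq> 0" "x4 \<noteq> 0" by auto
    then show ?thesis
    proof cases
      case 1 then show ?thesis by simp
    next
      case 2 then show ?thesis using s by simp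
    next
      case 3 then show ?thesis using s e(1,2) by simp
    next
      case 4 then show ?thesis using s e(1,3) by simp
    next
      case 5
      then have "x1 - x2 = -1" "x2 - x0 = -1" "x0 - x1 = -1" using e(1,2,3) by simp_all
      \<comment> \<open>The three equations add up to 0 = -3.\<close>
      then have False by algebra
      then show ?thesis ..
    next
      case 6
      then have "x1 + x3 = -1" "- x3 - x0 = -1" "- x0 + x1 = -1" using e(1,2,4) by simp_all
      then have False by algebra
      then show ?thesis ..
    next
      case 7
      then have "x1 - x2 + x3 = -1" "x2 - x3 - x0 = -1" "x3 + x0 - x1 = -1" "- x0 + x1 - x2 = -1"
        using e(1-4) by simp_all
      then have "x0 = 3" "x1 = 1" "x2 = -1" "x3 = -3" by algebra+
      with 7 show ?thesis by simp
    next
      case 8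
      \<comment> \<open>In the sum of all five equations every variable cancels, which leaves 0 =
        -5.\<close>
      then have False using e by algebra
      then show ?thesis ..
    qed
  qed
  with i show ?thesis unfolding x by blast
qed

text \<open>Same division by support as for the residues, now for the leading behaviour where the
  derivative does not contribute. It serves twice: to bound pole orders and to find the types at
  infinity.\<close>

lemma homogeneous_vector:
  fixes a :: "5 \<Rightarrow> complex"
  assumes eq: "\<And>j. a j * alt a j = 0"
  shows "\<exists>i c. (a i, a (i+1), a (i+2), a (i+3), a (i+4)) \<in>
    {(c,0,0,0,0), (c,c,c,0,0), (c,c,0,-c,0), (c,c,c,c,c)}"
proof -
  obtain i where i: "(a i \<noteq> 0, a (i+1) \<noteq> 0, a (i+2) \<noteq> 0, a (i+3) \<noteq> 0, a (i+4) \<noteq> 0) \<in>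
    {(False,False,False,False,False), (True,False,False,False,False),
     (True,True,False,False,False), (True,False,True,False,False),
     (True,True,True,False,False), (True,True,False,True,False),
     (True,True,True,True,False), (True,True,True,True,True)}"
    using bool_pattern_rotation[of "\<lambda>j. a j \<noteq> 0"] by blast
  define x0 x1 x2 x3 x4 where x: "x0 = a i" "x1 = a (i+1)" "x2 = a (i+2)" "x3 = a (i+3)" "x4 = a (i+4)"
  have e: "x0 \<noteq> 0 \<Longrightarrow> x1 - x2 + x3 - x4 = 0" "x1 \<noteq> 0 \<Longrightarrow> x2 - x3 + x4 - x0 = 0"
    "x2 \<noteq> 0 \<Longrightarrow> x3 - x4 + x0 - x1 = 0" "x3 \<noteq> 0 \<Longrightarrow> x4 - x0 + x1 - x2 = 0"
    "x4 \<noteq> 0 \<Longrightarrow> x0 - x1 + x2 - x3 = 0"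
    using eq[of i] eq[of "i+1"] eq[of "i+2"] eq[of "i+3"] eq[of "i+4"]
    by (simp_all add: alt_def x add.assoc)
  from i have pat: "(x0 \<noteq> 0, x1 \<noteq> 0, x2 \<noteq> 0, x3 \<noteq> 0, x4 \<noteq> 0) \<in>
    {(False,False,False,False,False), (True,False,False,False,False),
     (True,True,False,False,False), (True,False,True,False,False),
     (True,True,True,False,False), (True,True,False,True,False),
     (True,True,True,True,False), (True,True,True,True,True)}"
    unfolding x .
  have "\<exists>c. (x0,x1,x2,x3,x4) \<in> {(c,0,0,0,0), (c,c,c,0,0), (c,c,0,-c,0), (c,c,c,c,c)}"
  proof -
    from pat consider
        "x1 = 0" "x2 = 0" "x3 = 0" "x4 = 0"
      | "x0 \<noteq> 0" "x1 \<noteq> 0" "x2 = 0" "x3 = 0" "x4 = 0"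
      | "x0 \<noteq> 0" "x1 = 0" "x2 \<noteq> 0" "x3 = 0" "x4 = 0"
      | "x0 \<noteq> 0" "x1 \<noteq> 0" "x2 \<noteq> 0" "x3 = 0" "x4 = 0"
      | "x0 \<noteq> 0" "x1 \<noteq> 0" "x2 = 0" "x3 \<noteq> 0" "x4 = 0"
      | "x0 \<noteq> 0" "x1 \<noteq> 0" "x2 \<noteq> 0" "x3 \<noteq> 0" "x4 = 0"
      | "x0 \<noteq> 0" "x1 \<noteq> 0" "x2 \<noteq> 0" "x3 \<noteq> 0" "x4 \<noteq> 0" by auto
    then show ?thesis
    proof cases
      case 1 then show ?thesis by auto
    next
      case 2 then show ?thesis using e(1) by simp
    next
      case 3 then show ?thesis using e(1) by simp
    next
      case 4
      then have "x1 = x0" "x2 = x0" using e(2,3) by simp_all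
      then show ?thesis using 4 by (intro exI[of _ x0]) simp
    next
      case 5
      then have "- x3 - x0 = 0" "- x0 + x1 = 0" using e(2,4) by simp_all
      then have "x1 = x0" "x3 = - x0" by algebra+
      then show ?thesis using 5 by (intro exI[of _ x0]) simp
    next
      case 6
      then have "x1 - x2 + x3 = 0" "x2 - x3 - x0 = 0" "x3 + x0 - x1 = 0" using e(1-3) by simp_all
      \<comment> \<open>The three equations add up to \<open>x3 = 0\<close>, against the
        support.\<close>
      then have "x3 = 0" by algebra
      then show ?thesis using 6 by simp
    next
      case 7
      then have "x1 = x0" "x2 = x0" "x3 = x0" "x4 = x0" using e by algebra+
      then show ?thesis by (intro exI[of _ x0]) simp
    qed
  qed
  then show ?thesis unfolding x by blast
qed

section \<open>Rational functions, Laurent expansions and sums of residues\<close>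

lemma eventually_cofinite_imp_at:
  assumes "eventually P cofinite"
  shows "eventually P (at (z::'a::t1_space))"
proof -
  have "finite {x. \<not> P x}" using assms by (simp add: eventually_cofinite)
  then have "open (- ({x. \<not> P x} - {z}))" by (intro open_Compl finite_imp_closed) auto
  then show ?thesis unfolding eventually_at_topological
    by (intro exI[of _ "- ({x. \<not> P x} - {z})"]) auto
qed

lemma eventually_cofinite_compose_inj:
  assumes "eventually P cofinite" "inj g"
  shows "eventually (\<lambda>x. P (g x)) cofinite"
  using assms finite_vimageI[of "{x. \<not> P x}" g] by (simp add: eventually_cofinite vimage_def)

lemma inj_inverse_complex: "inj (inverse :: complex \<Rightarrow> complex)"
  by (rule injI) simp

lemma eventually_cofinite_neq: "eventually (\<lambda>x. x \<noteq> a) cofinite"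
  by (simp add: eventually_cofinite)

lemma eventually_cofinite_poly_nonzero:
  "q \<noteq> 0 \<Longrightarrow> eventually (\<lambda>t::complex. poly q t \<noteq> 0) cofinite"
  by (simp add: eventually_cofinite poly_roots_finite)

text \<open>Finitely many wrong values are absorbed by multiplying p and q with a polynomial that
  vanishes at them, since nothing is required where the denominator is zero.\<close>

lemma rational_fun_iff:
  "rational_fun h \<longleftrightarrow> (\<exists>p q. q \<noteq> 0 \<and> (\<forall>\<^sub>F t in cofinite. h t = poly p t / poly q t))"
proof
  assume "rational_fun h"
  then obtain p q where q: "q \<noteq> 0" and h: "\<And>z. poly q z \<noteq> 0 \<Longrightarrow> h z = poly p z / poly q z"
    unfolding rational_fun_def by blast
  have "\<forall>\<^sub>F t in cofinite. h t = poly p t / poly q t"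
    using eventually_cofinite_poly_nonzero[OF q] by eventually_elim (rule h)
  with q show "\<exists>p q. q \<noteq> 0 \<and> (\<forall>\<^sub>F t in cofinite. h t = poly p t / poly q t)" by blast
next
  assume "\<exists>p q. q \<noteq> 0 \<and> (\<forall>\<^sub>F t in cofinite. h t = poly p t / poly q t)"
  then obtain p q where q: "q \<noteq> 0" and h: "\<forall>\<^sub>F t in cofinite. h t = poly p t / poly q t" by blast
  define E where "E = {t. h t \<noteq> poly p t / poly q t}"
  have E: "finite E" using h by (simp add: eventually_cofinite E_def)
  define d where "d = (\<Prod>e\<in>E. [:-e, 1:])"
  have d: "d \<noteq> 0" using E by (simp add: d_def)
  have dE: "poly d z = 0" if "z \<in> E" for z
    using that E by (simp add: d_def poly_prod)
  have "h z = poly (p * d) z / poly (q * d) z" if "poly (q * d) z \<noteq> 0" for z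
  proof -
    have "poly d z \<noteq> 0" "z \<notin> E" using that dE[of z] by auto
    then show ?thesis by (simp add: E_def)
  qed
  moreover have "q * d \<noteq> 0" using q d by simp
  ultimately show "rational_fun h" unfolding rational_fun_def by blast
qed

lemma rational_fun_cong:
  assumes "\<forall>\<^sub>F t in cofinite. g t = h t" "rational_fun h"
  shows "rational_fun g"
proof -
  obtain p q where "q \<noteq> 0" "\<forall>\<^sub>F t in cofinite. h t = poly p t / poly q t"
    using assms(2) unfolding rational_fun_iff by blast
  moreover from this(2) assms(1) have "\<forall>\<^sub>F t in cofinite. g t = poly p t / poly q t"
    by eventually_elim simp
  ultimately show ?thesis unfolding rational_fun_iff by blast
qed

lemma rational_fun_const: "rational_fun (\<lambda>_. c)"
  unfolding rational_fun_def by (intro exI[of _ "[:c:]"] exI[of _ 1]) simp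

lemma rational_fun_ident: "rational_fun (\<lambda>t. t)"
  unfolding rational_fun_def by (intro exI[of _ "[:0, 1:]"] exI[of _ 1]) simp

lemma rational_fun_add:
  assumes "rational_fun g" "rational_fun h" shows "rational_fun (\<lambda>t. g t + h t)"
proof -
  obtain p q p' q' where q: "q \<noteq> 0" "q' \<noteq> 0"
    and gh: "\<forall>\<^sub>F t in cofinite. g t = poly p t / poly q t" "\<forall>\<^sub>F t in cofinite. h t = poly p' t / poly q' t"
    using assms unfolding rational_fun_iff by blast
  have "\<forall>\<^sub>F t in cofinite. g t + h t = poly (p * q' + p' * q) t / poly (q * q') t"
    using gh eventually_cofinite_poly_nonzero[OF q(1)] eventually_cofinite_poly_nonzero[OF q(2)]
    by eventually_elim (simp add: add_frac_eq)
  moreover have "q * q' \<noteq> 0" using q by simp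
  ultimately show ?thesis unfolding rational_fun_iff by blast
qed

lemma rational_fun_mult:
  assumes "rational_fun g" "rational_fun h" shows "rational_fun (\<lambda>t. g t * h t)"
proof -
  obtain p q p' q' where q: "q \<noteq> 0" "q' \<noteq> 0"
    and gh: "\<forall>\<^sub>F t in cofinite. g t = poly p t / poly q t" "\<forall>\<^sub>F t in cofinite. h t = poly p' t / poly q' t"
    using assms unfolding rational_fun_iff by blast
  have "\<forall>\<^sub>F t in cofinite. g t * h t = poly (p * p') t / poly (q * q') t"
    using gh by eventually_elim simp
  moreover have "q * q' \<noteq> 0" using q by simp
  ultimately show ?thesis unfolding rational_fun_iff by blast
qed

lemma rational_fun_inverse:
  assumes "rational_fun g" shows "rational_fun (\<lambda>t. inverse (g t))"
proof -
  obtain p q where q: "q \<noteq> 0" and g: "\<forall>\<^sub>F t in cofinite. g t = poly p t / poly q t"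
    using assms unfolding rational_fun_iff by blast
  show ?thesis
  proof (cases "p = 0")
    case True
    then have "\<forall>\<^sub>F t in cofinite. inverse (g t) = 0" using g by (simp add: eventually_mono)
    then show ?thesis by (rule rational_fun_cong) (rule rational_fun_const)
  next
    case False
    have "\<forall>\<^sub>F t in cofinite. inverse (g t) = poly q t / poly p t"
      using g by eventually_elim simp
    with False show ?thesis unfolding rational_fun_iff by blast
  qed
qed

lemma rational_fun_cmult: "rational_fun h \<Longrightarrow> rational_fun (\<lambda>t. c * h t)"
  by (rule rational_fun_mult[OF rational_fun_const])

lemma rational_fun_diff:
  "rational_fun g \<Longrightarrow> rational_fun h \<Longrightarrow> rational_fun (\<lambda>t. g t - h t)"
  using rational_fun_add[OF _ rational_fun_cmult[of h "-1"], of g] by simp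

lemma rational_fun_divide:
  "rational_fun g \<Longrightarrow> rational_fun h \<Longrightarrow> rational_fun (\<lambda>t. g t / h t)"
  unfolding divide_inverse by (intro rational_fun_mult rational_fun_inverse)

lemma rational_fun_sum:
  "(\<And>i. i \<in> A \<Longrightarrow> rational_fun (g i)) \<Longrightarrow> rational_fun (\<lambda>t. \<Sum>i\<in>A. g i t)"
  by (induction A rule: infinite_finite_induct) (auto intro: rational_fun_const rational_fun_add)

text \<open>Turns "f_i is not identically zero" into the permission to divide by f_i outside a
  finite set.\<close>

lemma rational_fun_zero_or_nonzero:
  assumes "rational_fun h"
  shows "(\<forall>\<^sub>F t in cofinite. h t = 0) \<or> (\<forall>\<^sub>F t in cofinite. h t \<noteq> 0)"
proof -
  obtain p q where q: "q \<noteq> 0" and h: "\<forall>\<^sub>F t in cofinite. h t = poly p t / poly q t"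
    using assms unfolding rational_fun_iff by blast
  show ?thesis
  proof (cases "p = 0")
    case True
    then show ?thesis using h by simp
  next
    case False
    have "\<forall>\<^sub>F t in cofinite. h t \<noteq> 0"
      using h eventually_cofinite_poly_nonzero[OF q] eventually_cofinite_poly_nonzero[OF False]
      by eventually_elim simp
    then show ?thesis ..
  qed
qed

section \<open>Laurent expansions at finite points and, in the variable 1/t, at infinity\<close>

lemma analytic_has_laurent_expansion:
  assumes "(\<lambda>w. g (z + w)) analytic_on {0}"
  shows "\<exists>F. (\<lambda>w. g (z + w)) has_laurent_expansion F \<and> (\<forall>n<0. F $$ n = 0) \<and> F $$ 0 = g z"
proof -
  obtain F where F: "(\<lambda>w. g (z + w)) has_fps_expansion F"
    using analytic_at_imp_has_fps_expansion_0[OF assms] by blast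
  have "fps_to_fls F $$ 0 = g z"
    using has_fps_expansion_imp_0_eq_fps_nth_0[OF F] by simp
  then show ?thesis using has_laurent_expansion_fps[OF F] by (intro exI[of _ "fps_to_fls F"]) simp
qed

lemma has_laurent_expansion_transfer:
  assumes "\<forall>\<^sub>F x in at 0. f x = g x" "g has_laurent_expansion F"
  shows "f has_laurent_expansion F"
  using assms has_laurent_expansion_cong by blast

lemma has_laurent_expansion_eq:
  assumes "\<forall>\<^sub>F x in at 0. f x = g x" "f has_laurent_expansion F" "g has_laurent_expansion G"
  shows "F = G"
  using has_laurent_expansion_unique[OF assms(2) has_laurent_expansion_transfer[OF assms(1,3)]] .

lemma poly_shift_analytic: "(\<lambda>w. poly p (z + w)) analytic_on A" for p :: "complex poly"
  by (induction p) (auto intro!: analytic_intros)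

lemma poly_has_laurent_expansion:
  fixes p :: "complex poly"
  shows "\<exists>F. (\<lambda>w. poly p (z + w)) has_laurent_expansion F \<and> (\<forall>n<0. F $$ n = 0) \<and> F $$ 0 = poly p z"
  by (rule analytic_has_laurent_expansion) (rule poly_shift_analytic)

lemma poly_inverse_has_laurent_expansion:
  fixes p :: "complex poly"
  shows "\<exists>F. (\<lambda>x. poly p (inverse x)) has_laurent_expansion F \<and>
    (\<forall>n. F $$ n = (if n \<le> 0 then coeff p (nat (- n)) else 0))"
proof (induction p)
  case 0
  then show ?case by (intro exI[of _ 0]) auto
next
  case (pCons a p)
  then obtain F where F: "(\<lambda>x. poly p (inverse x)) has_laurent_expansion F"
    and n: "\<And>n. F $$ n = (if n \<le> 0 then coeff p (nat (- n)) else 0)" by blast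
  have "(\<lambda>x. a + inverse x * poly p (inverse x)) has_laurent_expansion fls_const a + fls_shift 1 F"
    using has_laurent_expansion_add[OF has_laurent_expansion_const[of a] has_laurent_expansion_shift'[OF F, of 1]]
    by (simp add: power_int_minus mult.commute)
  moreover have "(fls_const a + fls_shift 1 F) $$ n = (if n \<le> 0 then coeff (pCons a p) (nat (- n)) else 0)" for n
  proof -
    consider "n > 0" | "n = 0" | "n < 0" by linarith
    then show ?thesis
    proof cases
      case 3
      then have "nat (- n) = Suc (nat (- (n + 1)))" by simp
      with 3 show ?thesis by (simp add: n)
    qed (simp_all add: n)
  qed
  ultimately show ?case unfolding poly_pCons by blast
qed

lemma rational_fun_has_laurent_expansion:
  assumes "rational_fun h"
  shows "\<exists>F. (\<lambda>w. h (z + w)) has_laurent_expansion F"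
proof -
  obtain p q where q: "q \<noteq> 0" and h: "\<forall>\<^sub>F t in cofinite. h t = poly p t / poly q t"
    using assms unfolding rational_fun_iff by blast
  obtain P Q where "(\<lambda>w. poly p (z + w)) has_laurent_expansion P" "(\<lambda>w. poly q (z + w)) has_laurent_expansion Q"
    using poly_has_laurent_expansion by blast
  then have PQ: "(\<lambda>w. poly p (z + w) / poly q (z + w)) has_laurent_expansion P / Q"
    by (rule has_laurent_expansion_divide)
  have "\<forall>\<^sub>F w in at 0. h (z + w) = poly p (z + w) / poly q (z + w)"
    using eventually_cofinite_imp_at[OF eventually_cofinite_compose_inj[OF h, of "\<lambda>w. z + w"]] by simp
  then show ?thesis by (intro exI[of _ "P / Q"]) (rule has_laurent_expansion_transfer[OF _ PQ])
qed

lemma rational_fun_inverse_has_laurent_expansion: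
  assumes "rational_fun h"
  shows "\<exists>F. (\<lambda>x. h (inverse x)) has_laurent_expansion F"
proof -
  obtain p q where q: "q \<noteq> 0" and h: "\<forall>\<^sub>F t in cofinite. h t = poly p t / poly q t"
    using assms unfolding rational_fun_iff by blast
  obtain P Q where "(\<lambda>w. poly p (inverse w)) has_laurent_expansion P" "(\<lambda>w. poly q (inverse w)) has_laurent_expansion Q"
    using poly_inverse_has_laurent_expansion by blast
  then have PQ: "(\<lambda>w. poly p (inverse w) / poly q (inverse w)) has_laurent_expansion P / Q"
    by (rule has_laurent_expansion_divide)
  have "\<forall>\<^sub>F w in at 0. h (inverse w) = poly p (inverse w) / poly q (inverse w)"
    using eventually_cofinite_imp_at[OF eventually_cofinite_compose_inj[OF h inj_inverse_complex]] by simp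
  then show ?thesis by (intro exI[of _ "P / Q"]) (rule has_laurent_expansion_transfer[OF _ PQ])
qed

section \<open>Partial fractions and the residue theorem on the sphere\<close>

text \<open>At a root z of q the regular expansion of k shows that p = k q vanishes at z too, so a
  linear factor cancels. The degree of the denominator drops until it is constant.\<close>

lemma polynomial_if_no_poles:
  fixes k :: "complex \<Rightarrow> complex"
  assumes "q \<noteq> 0" "\<forall>\<^sub>F t in cofinite. k t = poly p t / poly q t"
    and reg: "\<And>z. \<exists>F. (\<lambda>w. k (z + w)) has_laurent_expansion F \<and> (\<forall>n<0. F $$ n = 0)"
  shows "\<exists>R. \<forall>\<^sub>F t in cofinite. k t = poly R t"
  using assms(1,2)
proof (induction "degree q" arbitrary: p q rule: less_induct)
  case less
  show ?case
  proof (cases "degree q = 0")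
    case True
    then obtain c where c: "q = [:c:]" using degree_eq_zeroE by blast
    have "\<forall>\<^sub>F t in cofinite. k t = poly (smult (inverse c) p) t"
      using less.prems(2) by eventually_elim (simp add: c field_simps)
    then show ?thesis ..
  next
    case False
    then obtain z where z: "poly q z = 0"
      using alg_closed_imp_poly_has_root[of q] by auto
    obtain F where F: "(\<lambda>w. k (z + w)) has_laurent_expansion F" "\<And>n. n < 0 \<Longrightarrow> F $$ n = 0"
      using reg by blast
    obtain P where P: "(\<lambda>w. poly p (z + w)) has_laurent_expansion P" "P $$ 0 = poly p z"
      using poly_has_laurent_expansion by blast
    obtain Q where Q: "(\<lambda>w. poly q (z + w)) has_laurent_expansion Q" "\<And>n. n < 0 \<Longrightarrow> Q $$ n = 0" "Q $$ 0 = poly q z"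
      using poly_has_laurent_expansion by blast
    have "\<forall>\<^sub>F w in cofinite. k (z + w) = poly p (z + w) / poly q (z + w)"
      using eventually_cofinite_compose_inj[OF less.prems(2), of "\<lambda>w. z + w"] by simp
    moreover have "\<forall>\<^sub>F w in cofinite. poly q (z + w) \<noteq> 0"
      using eventually_cofinite_compose_inj[OF eventually_cofinite_poly_nonzero[OF less.prems(1)], of "\<lambda>w. z + w"] by simp
    ultimately have "\<forall>\<^sub>F w in cofinite. poly p (z + w) = k (z + w) * poly q (z + w)"
      by eventually_elim simp
    then have "\<forall>\<^sub>F w in at 0. poly p (z + w) = k (z + w) * poly q (z + w)"
      by (rule eventually_cofinite_imp_at)
    then have PFQ: "P = F * Q"
      by (rule has_laurent_expansion_eq[OF _ P(1) has_laurent_expansion_mult[OF F(1) Q(1)]])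
    have "fls_subdegree F \<ge> 0" using F(2) fls_subdegree_ge0I by blast
    then obtain F' where F': "F = fps_to_fls F'" using fls_as_fps[of F 0] by auto
    have "fls_subdegree Q \<ge> 0" using Q(2) fls_subdegree_ge0I by blast
    then obtain Q' where Q': "Q = fps_to_fls Q'" using fls_as_fps[of Q 0] by auto
    have "P $$ 0 = F' $ 0 * Q' $ 0"
      unfolding PFQ F' Q' by (simp flip: fls_times_fps_to_fls)
    moreover have "Q' $ 0 = 0" using Q(3) z by (simp add: Q')
    ultimately have "poly p z = 0" using P(2) by simp
    then obtain p1 where p1: "p = [:-z, 1:] * p1" by (meson dvdE poly_eq_0_iff_dvd)
    obtain q1 where q1: "q = [:-z, 1:] * q1" using z by (meson dvdE poly_eq_0_iff_dvd)
    have q1': "q1 \<noteq> 0" using less.prems(1) q1 by auto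
    then have "degree q = Suc (degree q1)" unfolding q1 by (subst degree_mult_eq) auto
    moreover have "\<forall>\<^sub>F t in cofinite. k t = poly p1 t / poly q1 t"
      using less.prems(2) eventually_cofinite_neq[of z]
    proof eventually_elim
      case (elim t)
      then have "poly [:-z, 1:] t \<noteq> 0" by simp
      then show ?case unfolding elim(1) p1 q1 poly_mult by (rule mult_divide_mult_cancel_left)
    qed
    ultimately show ?thesis using less.hyps[of q1 p1] q1' by simp
  qed
qed

text \<open>Subtracting all principal parts leaves a rational function without poles, that is, a
  polynomial. Finiteness holds because a nonzero residue needs a root of the denominator.\<close>

lemma simple_pole_expansion:
  assumes "rational_fun h"
    and exp: "\<And>z. \<exists>F. (\<lambda>w. h (z + w)) has_laurent_expansion F \<and> (\<forall>n. n < - 1 \<longrightarrow> F $$ n = 0) \<and> F $$ (-1) = \<rho> z"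
  shows "finite {z. \<rho> z \<noteq> 0}"
    and "\<exists>R. \<forall>\<^sub>F t in cofinite. h t = poly R t + (\<Sum>y | \<rho> y \<noteq> 0. \<rho> y / (t - y))"
proof -
  obtain p q where q: "q \<noteq> 0" and h: "\<forall>\<^sub>F t in cofinite. h t = poly p t / poly q t"
    using assms(1) unfolding rational_fun_iff by blast
  have "\<rho> z = 0" if z: "poly q z \<noteq> 0" for z
  proof -
    obtain F where F: "(\<lambda>w. h (z + w)) has_laurent_expansion F" "F $$ (-1) = \<rho> z" using exp by blast
    have an: "(\<lambda>w. poly p (z + w) / poly q (z + w)) analytic_on {0}"
      using z by (auto intro!: analytic_on_divide poly_shift_analytic)
    obtain G where G: "(\<lambda>w. poly p (z + w) / poly q (z + w)) has_laurent_expansion G" "\<And>n. n < 0 \<Longrightarrow> G $$ n = 0"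
      using analytic_has_laurent_expansion[OF an] by blast
    have "\<forall>\<^sub>F w in at 0. h (z + w) = poly p (z + w) / poly q (z + w)"
      using eventually_cofinite_imp_at[OF eventually_cofinite_compose_inj[OF h, of "\<lambda>w. z + w"]] by simp
    then have "F = G" by (rule has_laurent_expansion_eq[OF _ F(1) G(1)])
    then show ?thesis using F G by simp
  qed
  then have "{z. \<rho> z \<noteq> 0} \<subseteq> {z. poly q z = 0}" by blast
  then show fin: "finite {z. \<rho> z \<noteq> 0}" using poly_roots_finite[OF q] finite_subset by blast
  define k where "k = (\<lambda>t. h t - (\<Sum>y | \<rho> y \<noteq> 0. \<rho> y / (t - y)))"
  have "rational_fun k"
    unfolding k_def by (intro rational_fun_diff assms(1) rational_fun_sum rational_fun_divide rational_fun_const rational_fun_ident)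
  then obtain p' q' where k: "q' \<noteq> 0" "\<forall>\<^sub>F t in cofinite. k t = poly p' t / poly q' t"
    unfolding rational_fun_iff by blast
  have "\<exists>F. (\<lambda>w. k (z + w)) has_laurent_expansion F \<and> (\<forall>n<0. F $$ n = 0)" for z
  proof -
    obtain F where F: "(\<lambda>w. h (z + w)) has_laurent_expansion F" "\<And>n. n < -1 \<Longrightarrow> F $$ n = 0" "F $$ (-1) = \<rho> z"
      using exp by blast
    define S where "S = {y. \<rho> y \<noteq> 0} - {z}"
    have an: "(\<lambda>w. \<Sum>y\<in>S. \<rho> y / (z + w - y)) analytic_on {0}"
      by (auto intro!: analytic_intros simp: S_def)
    obtain G where G: "(\<lambda>w. \<Sum>y\<in>S. \<rho> y / (z + w - y)) has_laurent_expansion G" "\<And>n. n < 0 \<Longrightarrow> G $$ n = 0"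
      using analytic_has_laurent_expansion[OF an] by blast
    have X: "(\<lambda>w. \<rho> z / w) has_laurent_expansion fls_shift 1 (fls_const (\<rho> z))"
      using has_laurent_expansion_shift'[OF has_laurent_expansion_const[of "\<rho> z"], of 1]
      by (simp add: power_int_minus divide_inverse)
    have "k (z + w) = h (z + w) - (\<rho> z / w + (\<Sum>y\<in>S. \<rho> y / (z + w - y)))" for w
    proof (cases "\<rho> z = 0")
      case True
      then have "S = {y. \<rho> y \<noteq> 0}" by (auto simp: S_def)
      then show ?thesis using True by (simp add: k_def)
    next
      case False
      then have "{y. \<rho> y \<noteq> 0} = insert z S" "finite S" "z \<notin> S" using fin by (auto simp: S_def)
      then show ?thesis by (simp add: k_def)
    qed
    then have "(\<lambda>w. k (z + w)) has_laurent_expansion F - (fls_shift 1 (fls_const (\<rho> z)) + G)"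
      using has_laurent_expansion_diff[OF F(1) has_laurent_expansion_add[OF X G(1)]] by simp
    moreover have "(F - (fls_shift 1 (fls_const (\<rho> z)) + G)) $$ n = 0" if "n < 0" for n
    proof (cases "n = -1")
      case False
      then show ?thesis using that F(2)[of n] G(2)[of n] by simp
    qed (simp add: F G)
    ultimately show ?thesis by blast
  qed
  then obtain R where "\<forall>\<^sub>F t in cofinite. k t = poly R t"
    using polynomial_if_no_poles[OF k] by blast
  then have "\<forall>\<^sub>F t in cofinite. h t = poly R t + (\<Sum>y | \<rho> y \<noteq> 0. \<rho> y / (t - y))"
    by eventually_elim (simp add: k_def algebra_simps)
  then show "\<exists>R. \<forall>\<^sub>F t in cofinite. h t = poly R t + (\<Sum>y | \<rho> y \<noteq> 0. \<rho> y / (t - y))" ..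
qed

text \<open>With x = 1/t, each \<rho>/(t - y) equals \<rho> x + O(x^2), while the polynomial part
  has no positive powers of x.\<close>

lemma sum_of_residues:
  assumes h: "rational_fun h"
    and exp: "\<And>z. \<exists>F. (\<lambda>w. h (z + w)) has_laurent_expansion F \<and> (\<forall>n. n < - 1 \<longrightarrow> F $$ n = 0) \<and> F $$ (-1) = \<rho> z"
    and G: "(\<lambda>x. h (inverse x)) has_laurent_expansion G"
  shows "G $$ 1 = (\<Sum>y | \<rho> y \<noteq> 0. \<rho> y)"
proof -
  obtain R where R: "\<forall>\<^sub>F t in cofinite. h t = poly R t + (\<Sum>y | \<rho> y \<noteq> 0. \<rho> y / (t - y))"
    using simple_pole_expansion(2)[OF h exp] by blast
  obtain P where P: "(\<lambda>x. poly R (inverse x)) has_laurent_expansion P" "P $$ 1 = 0"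
    using poly_inverse_has_laurent_expansion[of R] by auto
  define E where "E y = fps_X * (fps_const (\<rho> y) * inverse (1 - fps_const y * fps_X))" for y
  have E: "(\<lambda>x. \<rho> y / (inverse x - y)) has_laurent_expansion fps_to_fls (E y)" for y
  proof -
    have "(\<lambda>x. x * (\<rho> y * inverse (1 - y * x))) has_fps_expansion E y"
      unfolding E_def by (intro fps_expansion_intros) simp
    then have L: "(\<lambda>x. x * (\<rho> y * inverse (1 - y * x))) has_laurent_expansion fps_to_fls (E y)"
      by (rule has_laurent_expansion_fps)
    have "\<forall>\<^sub>F x in at 0. \<rho> y / (inverse x - y) = x * (\<rho> y * inverse (1 - y * x))"
    proof -
      have "\<rho> y / (inverse x - y) = x * (\<rho> y * inverse (1 - y * x))" if "x \<noteq> 0" for x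
      proof -
        have "1 - y * x = x * (inverse x - y)" using that by (simp add: algebra_simps)
        then show ?thesis using that by (simp add: field_simps)
      qed
      then show ?thesis by (simp add: eventually_at_filter)
    qed
    then show ?thesis by (rule has_laurent_expansion_transfer[OF _ L])
  qed
  have E1: "E y $ Suc 0 = \<rho> y" for y
    by (simp add: E_def fps_mult_nth_1)
  have "\<forall>\<^sub>F x in at 0. h (inverse x) = poly R (inverse x) + (\<Sum>y | \<rho> y \<noteq> 0. \<rho> y / (inverse x - y))"
    using eventually_cofinite_imp_at[OF eventually_cofinite_compose_inj[OF R inj_inverse_complex]] by simp
  then have "G = P + (\<Sum>y | \<rho> y \<noteq> 0. fps_to_fls (E y))"
    by (rule has_laurent_expansion_eq[OF _ G has_laurent_expansion_add[OF P(1) has_laurent_expansion_sum[OF E]]])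
  then show ?thesis by (simp add: P(2) E1 fls_nth_sum)
qed

section \<open>Laurent expansions of rational solutions\<close>

lemma solution_expansion_at:
  assumes "rat_solution \<alpha> f"
  obtains F where "\<And>j. (\<lambda>w. f j (z + w)) has_laurent_expansion F j"
    "\<And>j. fls_deriv (F j) = F j * alt F j + fls_const (\<alpha> j)"
    "(\<Sum>j\<in>UNIV. F j) = fls_const z + fls_X"
proof -
  have rat: "\<And>j. rational_fun (f j)"
    and ev: "\<forall>\<^sub>F t in cofinite. (\<Sum>j\<in>UNIV. f j t) = t \<and>
        (\<forall>j. (f j has_field_derivative A4_rhs \<alpha> f j t) (at t))"
    using assms unfolding rat_solution_def by blast+
  obtain F where F: "\<And>j. (\<lambda>w. f j (z + w)) has_laurent_expansion F j"
    using rational_fun_has_laurent_expansion[OF rat, where z = z] by metis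
  have ev0: "\<forall>\<^sub>F w in at 0. (\<Sum>j\<in>UNIV. f j (z + w)) = z + w \<and>
        (\<forall>j. (f j has_field_derivative A4_rhs \<alpha> f j (z + w)) (at (z + w)))"
    using eventually_cofinite_imp_at[OF eventually_cofinite_compose_inj[OF ev, of "\<lambda>w. z + w"]] by simp
  then have "\<forall>\<^sub>F w in at 0. (\<Sum>j\<in>UNIV. f j (z + w)) = z + w"
    by (rule eventually_mono) blast
  then have sum: "(\<Sum>j\<in>UNIV. F j) = fls_const z + fls_X"
    by (rule has_laurent_expansion_eq[OF _ has_laurent_expansion_sum[OF F]
        has_laurent_expansion_add[OF has_laurent_expansion_const has_laurent_expansion_fps_X]])
  have "fls_deriv (F j) = F j * alt F j + fls_const (\<alpha> j)" for j
  proof -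
    obtain A where A: "open A" "0 \<in> A"
      and d: "\<And>w. w \<in> A - {0} \<Longrightarrow> (f j has_field_derivative A4_rhs \<alpha> f j (z + w)) (at (z + w))"
      using ev0 unfolding eventually_at_topological by blast
    have "(\<lambda>w. A4_rhs \<alpha> f j (z + w)) has_laurent_expansion fls_deriv (F j)"
      by (rule has_laurent_expansion_deriv'[OF F A]) (use d in \<open>simp add: DERIV_shift add.commute\<close>)
    moreover have "(\<lambda>w. A4_rhs \<alpha> f j (z + w)) has_laurent_expansion F j * alt F j + fls_const (\<alpha> j)"
      unfolding A4_rhs_def alt_def by (intro laurent_expansion_intros F)
    ultimately show ?thesis by (rule has_laurent_expansion_unique)
  qed
  with F sum show ?thesis using that by blast
qed

text \<open>The substitution x = 1/t turns d/dt into -x^2 d/dx; \<open>fls_shift (-2)\<close> is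
  multiplication by x^2.\<close>

lemma solution_expansion_infinity:
  assumes "rat_solution \<alpha> f"
  obtains G where "\<And>j. (\<lambda>x. f j (inverse x)) has_laurent_expansion G j"
    "\<And>j. fls_shift (-2) (fls_deriv (G j)) = - (G j * alt G j + fls_const (\<alpha> j))"
    "(\<Sum>j\<in>UNIV. G j) = fls_X_inv"
proof -
  have rat: "\<And>j. rational_fun (f j)"
    and ev: "\<forall>\<^sub>F t in cofinite. (\<Sum>j\<in>UNIV. f j t) = t \<and>
        (\<forall>j. (f j has_field_derivative A4_rhs \<alpha> f j t) (at t))"
    using assms unfolding rat_solution_def by blast+
  obtain G where G: "\<And>j. (\<lambda>x. f j (inverse x)) has_laurent_expansion G j"
    using rational_fun_inverse_has_laurent_expansion[OF rat] by metis
  have ev0: "\<forall>\<^sub>F x in at 0. (\<Sum>j\<in>UNIV. f j (inverse x)) = inverse x \<and>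
        (\<forall>j. (f j has_field_derivative A4_rhs \<alpha> f j (inverse x)) (at (inverse x)))"
    using eventually_cofinite_imp_at[OF eventually_cofinite_compose_inj[OF ev inj_inverse_complex]] by simp
  then have "\<forall>\<^sub>F x in at 0. (\<Sum>j\<in>UNIV. f j (inverse x)) = inverse x"
    by (rule eventually_mono) blast
  then have sum: "(\<Sum>j\<in>UNIV. G j) = fls_X_inv"
    by (rule has_laurent_expansion_eq[OF _ has_laurent_expansion_sum[OF G] has_laurent_expansion_fls_X_inv])
  have "fls_shift (-2) (fls_deriv (G j)) = - (G j * alt G j + fls_const (\<alpha> j))" for j
  proof -
    obtain A where A: "open A" "0 \<in> A"
      and d: "\<And>x. x \<in> A - {0} \<Longrightarrow> (f j has_field_derivative A4_rhs \<alpha> f j (inverse x)) (at (inverse x))"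
      using ev0 unfolding eventually_at_topological by blast
    have "((\<lambda>x. f j (inverse x)) has_field_derivative
        A4_rhs \<alpha> f j (inverse x) * - (inverse x ^ Suc (Suc 0))) (at x)" if "x \<in> A - {0}" for x
      using DERIV_chain'[OF DERIV_inverse d[OF that]] that by simp
    from has_laurent_expansion_deriv'[OF G A this]
    have "(\<lambda>x. A4_rhs \<alpha> f j (inverse x) * - (inverse x ^ Suc (Suc 0))) has_laurent_expansion fls_deriv (G j)" .
    from has_laurent_expansion_shift[OF this, of 2]
    have 1: "(\<lambda>x. A4_rhs \<alpha> f j (inverse x) * - (inverse x ^ Suc (Suc 0)) * x powi 2)
        has_laurent_expansion fls_shift (-2) (fls_deriv (G j))" .
    have 2: "(\<lambda>x. - A4_rhs \<alpha> f j (inverse x)) has_laurent_expansion - (G j * alt G j + fls_const (\<alpha> j))"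
      unfolding A4_rhs_def alt_def by (intro laurent_expansion_intros G)
    have "\<forall>\<^sub>F x in at 0. A4_rhs \<alpha> f j (inverse x) * - (inverse x ^ Suc (Suc 0)) * x powi 2 = - A4_rhs \<alpha> f j (inverse x)"
      by (simp add: eventually_at_filter field_simps power2_eq_square)
    then show ?thesis by (rule has_laurent_expansion_eq[OF _ 1 2])
  qed
  with G sum show ?thesis using that by blast
qed

section \<open>Orders and leading coefficients of the expansions\<close>

lemma fls_mult_nth_lowest:
  fixes F G :: "complex fls"
  assumes "\<And>n. n < m \<Longrightarrow> F $$ n = 0" "\<And>n. n < k \<Longrightarrow> G $$ n = 0"
  shows "(F * G) $$ (m + k) = F $$ m * G $$ k" "n < m + k \<Longrightarrow> (F * G) $$ n = 0"
proof -
  obtain \<phi> \<psi> where F: "F = fls_shift (-m) (fps_to_fls \<phi>)" and G: "G = fls_shift (-k) (fps_to_fls \<psi>)"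
  proof -
    have "- m \<ge> - fls_subdegree F \<or> F = 0" "- k \<ge> - fls_subdegree G \<or> G = 0"
      using fls_subdegree_geI assms by force+
    then obtain \<phi> \<psi> where "F = fls_shift (-m) (fps_to_fls \<phi>)" "G = fls_shift (-k) (fps_to_fls \<psi>)"
      using fls_as_fps'[of F "-m"] fls_as_fps'[of G "-k"]
      by (metis fls_shift_0 fls_shift_zero fps_zero_to_fls)
    then show ?thesis using that by blast
  qed
  have "F * G = fls_shift (- (m + k)) (fps_to_fls (\<phi> * \<psi>))"
    unfolding F G by (simp add: fls_times_both_shifted_simp fls_times_fps_to_fls add.commute)
  then show "(F * G) $$ (m + k) = F $$ m * G $$ k" "n < m + k \<Longrightarrow> (F * G) $$ n = 0"
    by (simp_all add: F G)
qed

lemma alt_nth: "alt F j $$ n = alt (\<lambda>k. F k $$ n) j" for F :: "5 \<Rightarrow> complex fls"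
  by (simp add: alt_def)

text \<open>The coefficients at order m solve the homogeneous system. Its solutions have coordinate
  sum c, 3c, c or 5c, so a vanishing sum forces c = 0.\<close>

lemma lowest_order_step:
  fixes F :: "5 \<Rightarrow> complex fls"
  assumes low: "\<And>j n. n < m \<Longrightarrow> F j $$ n = 0"
    and eq: "\<And>j. (F j * alt F j) $$ (2 * m) = 0" and sum: "(\<Sum>j\<in>UNIV. F j $$ m) = 0"
  shows "\<And>j n. n < m + 1 \<Longrightarrow> F j $$ n = 0"
proof -
  define a where "a j = F j $$ m" for j
  have hom: "a j * alt a j = 0" for j
  proof -
    have "alt F j $$ n = 0" if "n < m" for n using low[OF that] by (simp add: alt_nth alt_def)
    then have "(F j * alt F j) $$ (m + m) = F j $$ m * alt F j $$ m"
      using fls_mult_nth_lowest(1)[of m "F j" m "alt F j"] low by blast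
    then show ?thesis using eq[of j] by (simp add: a_def[abs_def] alt_nth)
  qed
  obtain i c where ic: "(a i, a (i+1), a (i+2), a (i+3), a (i+4)) \<in>
      {(c,0,0,0,0), (c,c,c,0,0), (c,c,0,-c,0), (c,c,c,c,c)}"
    using homogeneous_vector[of a, OF hom] by (elim exE)
  have "a i + a (i+1) + a (i+2) + a (i+3) + a (i+4) = 0"
    using sum sum_shift5[of a i] by (simp add: sum5 a_def)
  with ic have "a (i + j) = 0" for j
    using index5_cases[of j] by auto
  from this[of "j - i" for j] have "a j = 0" for j by simp
  then show "F j $$ n = 0" if "n < m + 1" for j n
    using low[of n j] that by (cases "n = m") (auto simp: a_def)
qed

text \<open>For m at most -2 the quadratic terms start at order 2m, below every other term of the
  system, so the lowest coefficients can be removed one order at a time until order -1.\<close>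

lemma order_at_least_minus_1:
  fixes F :: "5 \<Rightarrow> complex fls"
  assumes step: "\<And>m. m \<le> -2 \<Longrightarrow> (\<And>j n. n < m \<Longrightarrow> F j $$ n = 0) \<Longrightarrow>
      (\<forall>j. (F j * alt F j) $$ (2 * m) = 0) \<and> (\<Sum>j\<in>UNIV. F j $$ m) = 0"
  shows "\<And>j n. n < -1 \<Longrightarrow> F j $$ n = 0"
proof -
  define m0 where "m0 = Min (range (\<lambda>j. fls_subdegree (F j)))"
  have m0: "F j $$ n = 0" if "n < m0" for j n
  proof -
    have "m0 \<le> fls_subdegree (F j)" unfolding m0_def by (intro Min_le) auto
    with that show ?thesis by (intro fls_eq0_below_subdegree) simp
  qed
  have "\<forall>j n. n < m \<longrightarrow> F j $$ n = 0" if "m0 \<le> m" "m \<le> -1" for m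
    using that
  proof (induction m rule: int_ge_induct)
    case base
    then show ?case using m0 by blast
  next
    case (step m)
    then have low: "F j $$ n = 0" if "n < m" for j n using that by simp
    have "m \<le> -2" using step by simp
    from assms[OF this low] show ?case using lowest_order_step[of m F, OF low] by blast
  qed
  then show "F j $$ n = 0" if "n < -1" for j n
    using that m0 by (cases "m0 \<le> -1") auto
qed

lemma expansion_residues:
  fixes F :: "5 \<Rightarrow> complex fls"
  assumes eq: "\<And>j. fls_deriv (F j) = F j * alt F j + fls_const (\<alpha> j)"
    and sum: "(\<Sum>j\<in>UNIV. F j) = fls_const z + fls_X"
  shows "\<And>j n. n < -1 \<Longrightarrow> F j $$ n = 0"
    and "\<And>j. F j $$ (-1) * alt (\<lambda>k. F k $$ (-1)) j = - (F j $$ (-1))"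
    and "(\<Sum>j\<in>UNIV. F j $$ (-1)) = 0"
proof -
  have eqn: "of_int (n + 1) * F j $$ (n + 1) = (F j * alt F j) $$ n" if "n < 0" for j n
    using arg_cong[OF eq[of j], of "\<lambda>f. f $$ n"] that by simp
  have sumn: "(\<Sum>j\<in>UNIV. F j $$ n) = 0" if "n < 0" for n
    using arg_cong[OF sum, of "\<lambda>f. f $$ n"] that by (simp add: fls_nth_sum)
  show low: "F j $$ n = 0" if "n < -1" for j n
  proof (rule order_at_least_minus_1[OF _ that])
    fix m :: int assume m: "m \<le> -2" and low: "\<And>j n. n < m \<Longrightarrow> F j $$ n = 0"
    \<comment> \<open>Since \<open>2 * m + 1 < m\<close>, the derivative has no term at order
      \<open>2 * m\<close>.\<close>
    have "(F j * alt F j) $$ (2 * m) = 0" for j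
      using eqn[of "2 * m" j] low[of "2 * m + 1" j] m by simp
    then show "(\<forall>j. (F j * alt F j) $$ (2 * m) = 0) \<and> (\<Sum>j\<in>UNIV. F j $$ m) = 0"
      using sumn[of m] m by simp
  qed
  show "F j $$ (-1) * alt (\<lambda>k. F k $$ (-1)) j = - (F j $$ (-1))" for j
  proof -
    have "alt F j $$ n = 0" if "n < -1" for n using low[OF that] by (simp add: alt_nth alt_def)
    then have "(F j * alt F j) $$ (-1 + -1) = F j $$ (-1) * alt F j $$ (-1)"
      using fls_mult_nth_lowest(1)[of "-1" "F j" "-1" "alt F j"] low by blast
    then show ?thesis using eqn[of "-2" j] by (simp add: alt_nth)
  qed
  show "(\<Sum>j\<in>UNIV. F j $$ (-1)) = 0" using sumn[of "-1"] by simp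
qed

lemma expansion_infinity_order:
  fixes G :: "5 \<Rightarrow> complex fls"
  assumes eq: "\<And>j. fls_shift (-2) (fls_deriv (G j)) = - (G j * alt G j + fls_const (\<alpha> j))"
    and sum: "(\<Sum>j\<in>UNIV. G j) = fls_X_inv"
  shows "n < -1 \<Longrightarrow> G j $$ n = 0"
proof (rule order_at_least_minus_1[of G])
  fix m :: int assume m: "m \<le> -2" and low: "\<And>j n. n < m \<Longrightarrow> G j $$ n = 0"
  have "(G j * alt G j) $$ (2 * m) = 0" for j
    using arg_cong[OF eq[of j], of "\<lambda>f. f $$ (2 * m)"] low[of "2 * m - 1" j] m by simp
  moreover have "(\<Sum>j\<in>UNIV. G j $$ m) = 0"
    using arg_cong[OF sum, of "\<lambda>f. f $$ m"] m by (simp add: fls_nth_sum)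
  ultimately show "(\<forall>j. (G j * alt G j) $$ (2 * m) = 0) \<and> (\<Sum>j\<in>UNIV. G j $$ m) = 0" by simp
qed

section \<open>The Hamiltonian\<close>

text \<open>
  With respect to the bracket $\{f_j, f_{j+1}\} = 1$ the system reads $f_j' = \{h, f_j\} + \delta_{j0}$:
  the coefficients $c_j$ of the linear part of $h$ solve
  $c_{j-1} - c_{j+1} = \alpha_j - \delta_{j0}$ with $c_0 = 0$. Hence $h'$ is the partial derivative of $h$ with
  respect to $f_0$. The other four Hamiltonians are obtained by rotating the indices.
\<close>

definition ham :: "(5 \<Rightarrow> 'a::comm_ring_1) \<Rightarrow> (5 \<Rightarrow> 'a) \<Rightarrow> 'a" where
  "ham A x = x 0 * x 1 * x 2 + x 1 * x 2 * x 3 + x 2 * x 3 * x 4 + x 3 * x 4 * x 0 + x 4 * x 0 * x 1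
     + (A 2 + A 4) * x 1 - A 1 * x 2 + A 4 * x 3 - (A 1 + A 3) * x 4"

lemma ham_deriv:
  fixes F :: "5 \<Rightarrow> complex fls"
  assumes eq: "\<And>j. fls_deriv (F j) = F j * alt F j + fls_const (\<alpha> j)"
    and one: "(\<Sum>j\<in>UNIV. \<alpha> j) = 1"
  shows "fls_deriv (ham (\<lambda>j. fls_const (\<alpha> j)) F) = F 1 * F 2 + F 4 * F 1 + F 3 * F 4"
proof -
  define A where "A j = fls_const (\<alpha> j)" for j
  have [simp]: "fls_deriv (A j) = 0" for j by (simp add: A_def)
  \<comment> \<open>\<open>ham\<close> does not mention \<alpha>_0. The normalization of the
    parameters produces the inhomogeneity 1 in the equation of f_0, and with it the nonzero
    derivative of \<open>ham\<close>.\<close>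
  have A0: "A 0 = 1 - A 1 - A 2 - A 3 - A 4"
  proof -
    have "\<alpha> 0 = 1 - \<alpha> 1 - \<alpha> 2 - \<alpha> 3 - \<alpha> 4" using one by (simp add: sum5 algebra_simps)
    then show ?thesis unfolding A_def by (intro fls_eqI) simp
  qed
  have d: "fls_deriv (F 0) = F 0 * (F 1 - F 2 + F 3 - F 4) + (1 - A 1 - A 2 - A 3 - A 4)"
    "fls_deriv (F 1) = F 1 * (F 2 - F 3 + F 4 - F 0) + A 1"
    "fls_deriv (F 2) = F 2 * (F 3 - F 4 + F 0 - F 1) + A 2"
    "fls_deriv (F 3) = F 3 * (F 4 - F 0 + F 1 - F 2) + A 3"
    "fls_deriv (F 4) = F 4 * (F 0 - F 1 + F 2 - F 3) + A 4"
    unfolding A0[symmetric] by (simp_all add: eq alt_def A_def)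
  have "fls_deriv (ham A F) = F 1 * F 2 + F 4 * F 1 + F 3 * F 4"
    unfolding ham_def by (simp add: d) algebra
  then show ?thesis unfolding A_def .
qed

lemma ham_has_laurent_expansion:
  assumes "\<And>j. (\<lambda>w. u j w) has_laurent_expansion F j"
  shows "(\<lambda>w. ham \<alpha> (\<lambda>j. u j w)) has_laurent_expansion ham (\<lambda>j. fls_const (\<alpha> j)) F"
  unfolding ham_def by (intro laurent_expansion_intros assms)

text \<open>A cubic in functions with simple poles could have a triple pole, but its derivative is
  only quadratic and has order at least -2. So \<open>ham\<close> has at most a simple pole, whose
  residue is read off from the double pole of the derivative.\<close>

lemma ham_residue:
  fixes F :: "5 \<Rightarrow> complex fls"
  assumes eq: "\<And>j. fls_deriv (F j) = F j * alt F j + fls_const (\<alpha> j)"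
    and sum: "(\<Sum>j\<in>UNIV. F j) = fls_const z + fls_X" and one: "(\<Sum>j\<in>UNIV. \<alpha> j) = 1"
  defines "H \<equiv> ham (\<lambda>j. fls_const (\<alpha> j)) F"
  shows "\<And>n. n < -1 \<Longrightarrow> H $$ n = 0"
    and "H $$ (-1) = - (F 1 $$ (-1) * F 2 $$ (-1) + F 4 $$ (-1) * F 1 $$ (-1) + F 3 $$ (-1) * F 4 $$ (-1))"
proof -
  note low = expansion_residues(1)[OF eq sum]
  have Hn: "of_int (n + 1) * H $$ (n + 1) = (F 1 * F 2) $$ n + (F 4 * F 1) $$ n + (F 3 * F 4) $$ n" for n
    using arg_cong[OF ham_deriv[OF eq one], of "\<lambda>f. f $$ n"] by (simp add: H_def)
  have lo: "(F i * F j) $$ n = 0" if "n < -2" for i j n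
    using fls_mult_nth_lowest(2)[of "-1" "F i" "-1" "F j"] low that by simp
  have top: "(F i * F j) $$ (-2) = F i $$ (-1) * F j $$ (-1)" for i j
    using fls_mult_nth_lowest(1)[of "-1" "F i" "-1" "F j"] low by simp
  show "H $$ n = 0" if "n < -1" for n
    using Hn[of "n - 1"] lo[of "n - 1"] that by simp
  show "H $$ (-1) = - (F 1 $$ (-1) * F 2 $$ (-1) + F 4 $$ (-1) * F 1 $$ (-1) + F 3 $$ (-1) * F 4 $$ (-1))"
    using Hn[of "-2"] by (simp add: top minus_equation_iff[of "H $$ (-1)"])
qed

section \<open>The expansion at infinity: types, integrals of motion, and the coefficient of
  1/t\<close>

lemma leading_vector:
  fixes a :: "5 \<Rightarrow> complex"
  assumes hom: "\<And>j. a j * alt a j = 0" and sum: "(\<Sum>j\<in>UNIV. a j) = 1"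
  shows "\<exists>i. (a i, a (i+1), a (i+2), a (i+3), a (i+4)) \<in>
    {(1,0,0,0,0), (1/3,1/3,1/3,0,0), (1,1,0,-1,0), (1/5,1/5,1/5,1/5,1/5)}"
proof -
  obtain i c where ic: "(a i, a (i+1), a (i+2), a (i+3), a (i+4)) \<in>
      {(c,0,0,0,0), (c,c,c,0,0), (c,c,0,-c,0), (c,c,c,c,c)}"
    using homogeneous_vector[of a, OF hom] by (elim exE)
  have s: "a i + a (i+1) + a (i+2) + a (i+3) + a (i+4) = 1"
    using sum sum_shift5[of a i] by (simp add: sum5)
  from ic consider "(a i, a (i+1), a (i+2), a (i+3), a (i+4)) = (c,0,0,0,0)"
    | "(a i, a (i+1), a (i+2), a (i+3), a (i+4)) = (c,c,c,0,0)"
    | "(a i, a (i+1), a (i+2), a (i+3), a (i+4)) = (c,c,0,-c,0)"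
    | "(a i, a (i+1), a (i+2), a (i+3), a (i+4)) = (c,c,c,c,c)"
    by (elim insertE emptyE)
  then show ?thesis
  proof cases
    case 1
    then have "c = 1" using s by simp
    then show ?thesis by (intro exI[of _ i]) (simp only: 1 insert_iff simp_thms)
  next
    case 2
    then have "c = 1/3" using s by (simp add: field_simps)
    then show ?thesis by (intro exI[of _ i]) (simp only: 2 insert_iff simp_thms)
  next
    case 3
    then have "c = 1" using s by simp
    then show ?thesis by (intro exI[of _ i]) (simp only: 3 insert_iff simp_thms)
  next
    case 4
    then have "c = 1/5" using s by (simp add: field_simps)
    then show ?thesis by (intro exI[of _ i]) (simp only: 4 insert_iff simp_thms)
  qed
qed

text \<open>The constant terms of the expansion at infinity satisfy the system linearized at the
  leading vector, so they must vanish. Injectivity is verified for each of the four types.\<close>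

lemma linearization_injective:
  fixes a d :: "5 \<Rightarrow> complex"
  assumes hom: "\<And>j. a j * alt a j = 0" and sum: "(\<Sum>j\<in>UNIV. a j) = 1"
    and lin: "\<And>j. a j * alt d j + d j * alt a j = 0" and dsum: "(\<Sum>j\<in>UNIV. d j) = 0"
  shows "d j = 0"
proof -
  obtain i where i: "(a i, a (i+1), a (i+2), a (i+3), a (i+4)) \<in>
      {(1,0,0,0,0), (1/3,1/3,1/3,0,0), (1,1,0,-1,0), (1/5,1/5,1/5,1/5,1/5)}"
    using leading_vector[of a, OF hom sum] by (elim exE)
  define x0 x1 x2 x3 x4 where x: "x0 = d i" "x1 = d (i+1)" "x2 = d (i+2)" "x3 = d (i+3)" "x4 = d (i+4)"
  define a0 a1 a2 a3 a4 where a: "a0 = a i" "a1 = a (i+1)" "a2 = a (i+2)" "a3 = a (i+3)" "a4 = a (i+4)"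
  have e: "a0 * (x1 - x2 + x3 - x4) + x0 * (a1 - a2 + a3 - a4) = 0"
    "a1 * (x2 - x3 + x4 - x0) + x1 * (a2 - a3 + a4 - a0) = 0"
    "a2 * (x3 - x4 + x0 - x1) + x2 * (a3 - a4 + a0 - a1) = 0"
    "a3 * (x4 - x0 + x1 - x2) + x3 * (a4 - a0 + a1 - a2) = 0"
    "a4 * (x0 - x1 + x2 - x3) + x4 * (a0 - a1 + a2 - a3) = 0"
    using lin[of i] lin[of "i+1"] lin[of "i+2"] lin[of "i+3"] lin[of "i+4"]
    by (simp_all add: alt_def x a add.assoc)
  have s: "x0 + x1 + x2 + x3 + x4 = 0"
    using dsum sum_shift5[of d i] by (simp add: sum5 x)
  have "(a0,a1,a2,a3,a4) = (1,0,0,0,0) \<or> (a0,a1,a2,a3,a4) = (1/3,1/3,1/3,0,0)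
      \<or> (a0,a1,a2,a3,a4) = (1,1,0,-1,0) \<or> (a0,a1,a2,a3,a4) = (1/5,1/5,1/5,1/5,1/5)"
    using i by (simp add: a)
  then have z: "x0 = 0 \<and> x1 = 0 \<and> x2 = 0 \<and> x3 = 0 \<and> x4 = 0"
  proof (elim disjE)
    assume "(a0,a1,a2,a3,a4) = (1,0,0,0,0)"
    then show ?thesis using e s by simp
  next
    assume "(a0,a1,a2,a3,a4) = (1/3,1/3,1/3,0,0)"
    then have v: "a0 = 1/3" "a1 = 1/3" "a2 = 1/3" "a3 = 0" "a4 = 0" by blast+
    have z: "x3 = 0" "x4 = 0" using e(4,5)[unfolded v] by simp_all
    have "x1 = x2" "x2 = x0" using e(1,2)[unfolded v] z by simp_all
    then show ?thesis using s z by simp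
  next
    assume "(a0,a1,a2,a3,a4) = (1,1,0,-1,0)"
    then have v: "a0 = 1" "a1 = 1" "a2 = 0" "a3 = -1" "a4 = 0" by blast+
    have z: "x2 = 0" "x4 = 0" using e(3,5)[unfolded v] by simp_all
    have "x1 + x3 = 0" "- x3 - x0 = 0" using e(1,2)[unfolded v] z by simp_all
    moreover have "x0 + x1 + x3 = 0" using s z by simp
    ultimately have "x0 = 0" "x1 = 0" "x3 = 0" by algebra+
    then show ?thesis using z by simp
  next
    assume "(a0,a1,a2,a3,a4) = (1/5,1/5,1/5,1/5,1/5)"
    then have v: "a0 = 1/5" "a1 = 1/5" "a2 = 1/5" "a3 = 1/5" "a4 = 1/5" by blast+
    have "x1 - x2 + x3 - x4 = 0" "x2 - x3 + x4 - x0 = 0" "x3 - x4 + x0 - x1 = 0" "x4 - x0 + x1 - x2 = 0"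
      using e(1-4)[unfolded v] by simp_all
    with s have "x0 = 0" "x1 = 0" "x2 = 0" "x3 = 0" "x4 = 0" by algebra+
    then show ?thesis by simp
  qed
  have "d (i + k) = 0" for k using z index5_cases[of k] by (auto simp: x)
  from this[of "j - i"] show ?thesis by simp
qed

text \<open>The part of degree 1 in a and degree 2 in b of the cubic \<Sum> x_j x_(j+1) x_(j+2) at x
  = a + b; \<open>lin\<close> below is the linear part of \<open>ham\<close>.\<close>

definition quad :: "(5 \<Rightarrow> 'a::comm_ring_1) \<Rightarrow> (5 \<Rightarrow> 'a) \<Rightarrow> 'a" where
  "quad a b = (\<Sum>j\<in>UNIV. a j * b (j+1) * b (j+2) + b j * a (j+1) * b (j+2) + b j * b (j+1) * a (j+2))"

definition lin :: "(5 \<Rightarrow> 'a::comm_ring_1) \<Rightarrow> (5 \<Rightarrow> 'a) \<Rightarrow> 'a" where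
  "lin \<alpha> b = (\<alpha> 2 + \<alpha> 4) * b 1 - \<alpha> 1 * b 2 + \<alpha> 4 * b 3 - (\<alpha> 1 + \<alpha> 3) * b 4"

lemma fps_mult_nth_2:
  "(p * q) $ 2 = p $ 0 * q $ 2 + p $ 1 * q $ 1 + p $ 2 * q $ 0" for p q :: "complex fps"
proof -
  have "{0..2::nat} = {0,1,2}" by auto
  then show ?thesis by (simp add: fps_mult_nth)
qed

lemma fps_mult_nth_4:
  "(p * q) $ 4 = p $ 0 * q $ 4 + p $ 1 * q $ 3 + p $ 2 * q $ 2 + p $ 3 * q $ 1 + p $ 4 * q $ 0"
  for p q :: "complex fps"
proof -
  have "{0..4::nat} = {0,1,2,3,4}" by auto
  then show ?thesis by (simp add: fps_mult_nth)
qed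

lemma fps_triple_nth_4:
  fixes p q r :: "complex fps"
  assumes "p $ 1 = 0" "q $ 1 = 0" "r $ 1 = 0"
  shows "(p * q * r) $ 4 = p $ 0 * q $ 0 * r $ 4 + p $ 0 * q $ 4 * r $ 0 + p $ 4 * q $ 0 * r $ 0
    + p $ 0 * q $ 2 * r $ 2 + p $ 2 * q $ 0 * r $ 2 + p $ 2 * q $ 2 * r $ 0"
proof -
  have "(p * q) $ 1 = 0" using assms by (simp add: fps_mult_nth_1)
  then show ?thesis
    unfolding fps_mult_nth_4[of "p * q"] fps_mult_nth_4[of p] fps_mult_nth_2 fps_mult_nth_0
    by (simp only: assms) (simp add: algebra_simps)
qed

text \<open>G_j = a_j/x + d_j + b_j x + ... + e_j x^3 + ...; orders x^(-2), x^(-1), x^0 of the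
  system give the equations for a, d and b. The coefficient of x in a cubic monomial involves e
  linearly, and the point of the last claim is that e drops out.\<close>

lemma expansion_infinity_coefficients:
  fixes G :: "5 \<Rightarrow> complex fls"
  assumes eq: "\<And>j. fls_shift (-2) (fls_deriv (G j)) = - (G j * alt G j + fls_const (\<alpha> j))"
    and sum: "(\<Sum>j\<in>UNIV. G j) = fls_X_inv"
  defines "a \<equiv> \<lambda>j. G j $$ (-1)" and "b \<equiv> \<lambda>j. G j $$ 1"
  shows "\<And>j. a j * alt a j = 0" "(\<Sum>j\<in>UNIV. a j) = 1"
    "\<And>j. a j = a j * alt b j + b j * alt a j + \<alpha> j" "(\<Sum>j\<in>UNIV. b j) = 0"
    "\<And>j. G j $$ 0 = 0"
    "ham (\<lambda>j. fls_const (\<alpha> j)) G $$ 1 = quad a b + lin \<alpha> b"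
proof -
  note low = expansion_infinity_order[OF eq sum]
  have "\<exists>g. G j = fls_shift 1 (fps_to_fls g)" for j
  proof (cases "G j = 0")
    case True
    then show ?thesis by (intro exI[of _ 0]) simp
  next
    case False
    then have "fls_subdegree (G j) \<ge> -1" using low by (intro fls_subdegree_geI) auto
    then show ?thesis by (intro fls_as_fps') simp
  qed
  then obtain g where g: "\<And>j. G j = fls_shift 1 (fps_to_fls (g j))" by metis
  have ag: "alt G j = fls_shift 1 (fps_to_fls (alt g j))" for j
    by (intro fls_eqI) (simp add: alt_def g)
  have prod: "G j * alt G j = fls_shift 2 (fps_to_fls (g j * alt g j))" for j
    unfolding g[of j] ag by (simp add: fls_times_both_shifted_simp fls_times_fps_to_fls)
  have en: "of_int (n - 1) * G j $$ (n - 1) = - ((G j * alt G j) $$ n + (if n = 0 then \<alpha> j else 0))" for j n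
    using arg_cong[OF eq[of j], of "\<lambda>f. f $$ n"] by simp
  have sumn: "(\<Sum>j\<in>UNIV. G j $$ n) = (if n = -1 then 1 else 0)" for n
    using arg_cong[OF sum, of "\<lambda>f. f $$ n"] by (simp add: fls_nth_sum)
  define d where "d j = G j $$ 0" for j
  define e where "e j = G j $$ 3" for j
  have gc: "g j $ 0 = a j" "g j $ 1 = d j" "g j $ 2 = b j" "g j $ 4 = e j" for j
    by (simp_all add: a_def b_def d_def e_def g)
  have alts: "alt g j $ n = alt (\<lambda>k. g k $ n) j" for j n by (simp add: alt_def)
  show hom: "a j * alt a j = 0" for j
    using en[of "-2" j] low[of "-3" j] by (simp add: prod alts gc)
  show asum: "(\<Sum>j\<in>UNIV. a j) = 1" using sumn[of "-1"] by (simp add: a_def)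
  have lin0: "a j * alt d j + d j * alt a j = 0" for j
  proof -
    have "(G j * alt G j) $$ (-1) = a j * alt d j + d j * alt a j"
      by (simp add: prod alts gc gc(2)[simplified])
    moreover have "(G j * alt G j) $$ (-1) = 0" using en[of "-1" j] low[of "-2" j] by simp
    ultimately show ?thesis by (simp only:)
  qed
  have "(\<Sum>j\<in>UNIV. d j) = 0" using sumn[of 0] by (simp add: d_def)
  then have d0: "d j = 0" for j using linearization_injective[OF hom asum lin0] by blast
  then show "G j $$ 0 = 0" for j by (simp add: d_def)
  show "a j = a j * alt b j + b j * alt a j + \<alpha> j" for j
  proof -
    have "(G j * alt G j) $$ 0 = a j * alt b j + b j * alt a j"
      by (simp add: prod fps_mult_nth_2 alts gc gc(2)[simplified] d0)
    moreover have "- a j = - ((G j * alt G j) $$ 0 + \<alpha> j)" using en[of 0 j] by (simp add: a_def)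
    ultimately show ?thesis by (simp only: neg_equal_iff_equal)
  qed
  show "(\<Sum>j\<in>UNIV. b j) = 0" using sumn[of 1] by (simp add: b_def)
  have esum: "e 0 + e 1 + e 2 + e 3 + e 4 = 0" using sumn[of 3] by (simp add: e_def sum5)
  have tri: "(G i * G j * G k) $$ 1 = a i * a j * e k + a i * e j * a k + e i * a j * a k
      + a i * b j * b k + b i * a j * b k + b i * b j * a k" for i j k
  proof -
    have "G i * G j * G k = fls_shift 3 (fps_to_fls (g i * g j * g k))"
      unfolding g by (simp add: fls_times_both_shifted_simp fls_times_fps_to_fls)
    then show ?thesis using fps_triple_nth_4[of "g i" "g j" "g k"] by (simp add: gc gc(2)[simplified] d0)
  qed
  have l: "(fls_const c * G j) $$ 1 = c * b j" for c j by (simp add: b_def)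
  \<comment> \<open>\<open>D j\<close> is the partial derivative of the cubic with respect to x_j at
    a. The homogeneous equations say that D is unchanged by steps of 2 in the index, hence constant,
    and the e_j sum to zero.\<close>
  define D where "D j = a (j+1) * a (j+2) + a (j+4) * a (j+1) + a (j+3) * a (j+4)" for j
  have "D 4 - D 1 = a 0 * alt a 0" "D 0 - D 2 = a 1 * alt a 1"
    "D 1 - D 3 = a 2 * alt a 2" "D 2 - D 4 = a 3 * alt a 3"
    by (simp_all add: D_def alt_def algebra_simps)
  then have "e 0 * D 0 + e 1 * D 1 + e 2 * D 2 + e 3 * D 3 + e 4 * D 4 = (e 0 + e 1 + e 2 + e 3 + e 4) * D 0"
    by (simp add: hom algebra_simps)
  then have eD: "e 0 * D 0 + e 1 * D 1 + e 2 * D 2 + e 3 * D 3 + e 4 * D 4 = 0" by (simp add: esum)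
  have "ham (\<lambda>j. fls_const (\<alpha> j)) G $$ 1 =
      (e 0 * D 0 + e 1 * D 1 + e 2 * D 2 + e 3 * D 3 + e 4 * D 4) + quad a b + lin \<alpha> b"
    unfolding ham_def fls_plus_nth fls_minus_nth tri fls_plus_const l
    by (simp add: D_def quad_def lin_def sum5 algebra_simps)
  then show "ham (\<lambda>j. fls_const (\<alpha> j)) G $$ 1 = quad a b + lin \<alpha> b" by (simp add: eD)
qed

section \<open>Asymptotics of rational solutions\<close>

lemma shift5_left: "(\<forall>j. P (i + j)) \<longleftrightarrow> (\<forall>j::5. P j)"
  by (metis add_diff_cancel_left' diff_add_cancel add.commute)

text \<open>The residue of the Hamiltonian based at J, in terms of the residue vector of the
  solution.\<close>

definition pole_weight :: "(5 \<Rightarrow> complex) \<Rightarrow> 5 \<Rightarrow> complex" where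
  "pole_weight r J = - (r (J+1) * r (J+2) + r (J+4) * r (J+1) + r (J+3) * r (J+4))"

text \<open>Read off from the four residue vectors. The last claim says that the five Hamiltonians
  together detect every pole.\<close>

lemma residue_vector_properties:
  fixes r :: "5 \<Rightarrow> complex"
  assumes eq: "\<And>j. r j * alt r j = - r j" and sum: "(\<Sum>j\<in>UNIV. r j) = 0"
  shows "r j \<in> \<int>" "pole_weight r J \<in> {0,1,3}" "(\<And>J. pole_weight r J = 0) \<Longrightarrow> r j = 0"
proof -
  obtain i where "(r i, r (i+1), r (i+2), r (i+3), r (i+4)) \<in>
      {(0,0,0,0,0), (1,-1,0,0,0), (-1,0,1,0,0), (3,1,-1,-3,0)}"
    using residue_vector[of r, OF eq sum] by (elim exE)
  then consider "(r i, r (i+1), r (i+2), r (i+3), r (i+4)) = (0,0,0,0,0)"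
    | "(r i, r (i+1), r (i+2), r (i+3), r (i+4)) = (1,-1,0,0,0)"
    | "(r i, r (i+1), r (i+2), r (i+3), r (i+4)) = (-1,0,1,0,0)"
    | "(r i, r (i+1), r (i+2), r (i+3), r (i+4)) = (3,1,-1,-3,0)"
    by (elim insertE emptyE)
  then have "(\<forall>k. r (i + k) \<in> \<int>) \<and> (\<forall>k. pole_weight r (i + k) \<in> {0,1,3}) \<and>
    ((\<forall>k. pole_weight r (i + k) = 0) \<longrightarrow> (\<forall>k. r (i + k) = 0))"
    unfolding all5 by cases (simp_all add: pole_weight_def add.assoc)
  then have "(\<forall>k. r k \<in> \<int>) \<and> (\<forall>k. pole_weight r k \<in> {0,1,3}) \<and>
    ((\<forall>J. pole_weight r J = 0) \<longrightarrow> (\<forall>k. r k = 0))"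
    unfolding shift5_left[of "\<lambda>k. r k \<in> \<int>"] shift5_left[of "\<lambda>k. pole_weight r k \<in> {0,1,3}"]
      shift5_left[of "\<lambda>k. pole_weight r k = 0"] shift5_left[of "\<lambda>k. r k = 0"] .
  then show "r j \<in> \<int>" "pole_weight r J \<in> {0,1,3}" "(\<And>J. pole_weight r J = 0) \<Longrightarrow> r j = 0"
    by blast+
qed

lemma quad_shift: "quad (\<lambda>k. a (i + k)) (\<lambda>k. b (i + k)) = quad a b"
  unfolding quad_def
  using sum_shift5[of "\<lambda>j. a j * b (j+1) * b (j+2) + b j * a (j+1) * b (j+2) + b j * b (j+1) * a (j+2)" i]
  by (simp add: add.assoc)

lemma rational_fun_ham:
  assumes "\<And>j. rational_fun (f j)"
  shows "rational_fun (\<lambda>t. ham \<alpha> (\<lambda>j. f j t))"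
  unfolding ham_def by (intro rational_fun_add rational_fun_diff rational_fun_mult rational_fun_const assms)

text \<open>Gathers all that is used about a rational solution: algebraic constraints on (a, b),
  nonnegativity of the five coefficients, and the fact that the solution is linear when all five
  vanish.\<close>

lemma solution_asymptotics:
  assumes sol: "rat_solution \<alpha> f" and one: "(\<Sum>j\<in>UNIV. \<alpha> j) = 1"
  obtains a b where "\<And>j. a j * alt a j = 0" "(\<Sum>j\<in>UNIV. a j) = 1"
    "\<And>j. a j = a j * alt b j + b j * alt a j + \<alpha> j" "(\<Sum>j\<in>UNIV. b j) = 0"
    "\<And>j. b j \<in> \<int>"
    "\<And>J. \<exists>x\<ge>0. quad a b + lin (\<lambda>k. \<alpha> (J + k)) (\<lambda>k. b (J + k)) = complex_of_real x"
    "(\<forall>J. quad a b + lin (\<lambda>k. \<alpha> (J + k)) (\<lambda>k. b (J + k)) = 0) \<longrightarrow>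
      (\<forall>j. \<forall>\<^sub>F t in cofinite. f j t = a j * t)"
proof -
  have rat: "rational_fun (f j)" for j using sol unfolding rat_solution_def by blast
  have "\<exists>F. (\<forall>j. (\<lambda>w. f j (z + w)) has_laurent_expansion F j) \<and>
      (\<forall>j. fls_deriv (F j) = F j * alt F j + fls_const (\<alpha> j)) \<and>
      (\<Sum>j\<in>UNIV. F j) = fls_const z + fls_X" for z
    using solution_expansion_at[OF sol, of z] by metis
  then obtain F where F: "\<And>z j. (\<lambda>w. f j (z + w)) has_laurent_expansion F z j"
    "\<And>z j. fls_deriv (F z j) = F z j * alt (F z) j + fls_const (\<alpha> j)"
    "\<And>z. (\<Sum>j\<in>UNIV. F z j) = fls_const z + fls_X"
    by metis
  define r where "r z j = F z j $$ (-1)" for z j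
  note res = expansion_residues[OF F(2) F(3), folded r_def]
  note rv = residue_vector_properties[OF res(2,3)]
  obtain G where G: "\<And>j. (\<lambda>x. f j (inverse x)) has_laurent_expansion G j"
    "\<And>j. fls_shift (-2) (fls_deriv (G j)) = - (G j * alt G j + fls_const (\<alpha> j))"
    "(\<Sum>j\<in>UNIV. G j) = fls_X_inv"
    using solution_expansion_infinity[OF sol] by metis
  define a b where "a j = G j $$ (-1)" and "b j = G j $$ 1" for j
  note coef = expansion_infinity_coefficients[OF G(2,3), folded a_def[abs_def] b_def[abs_def] a_def b_def]
  have fexp: "\<exists>H. (\<lambda>w. f j (z + w)) has_laurent_expansion H \<and> (\<forall>n. n < - 1 \<longrightarrow> H $$ n = 0) \<and> H $$ (-1) = r z j" for j z
    using F(1)[of j z] res(1)[of _ z j] by (auto simp: r_def)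
  have b: "b j = (\<Sum>z | r z j \<noteq> 0. r z j)" for j
    using sum_of_residues[OF rat fexp G(1)] by (simp add: b_def)
  have bint: "b j \<in> \<int>" for j
    unfolding b by (rule Ints_sum) (rule rv(1))
  have n: "quad a b + lin (\<lambda>k. \<alpha> (J + k)) (\<lambda>k. b (J + k)) = (\<Sum>z | pole_weight (r z) J \<noteq> 0. pole_weight (r z) J)"
    and nfin: "finite {z. pole_weight (r z) J \<noteq> 0}" for J
  proof -
    \<comment> \<open>The system is invariant under rotation, so the results for \<open>ham\<close>
      apply to the data shifted by J; \<open>quad\<close> does not see the shift, \<open>lin\<close>
      does.\<close>
    let ?\<alpha> = "\<lambda>k. \<alpha> (J + k)" and ?f = "\<lambda>k. f (J + k)" and ?F = "\<lambda>z k. F z (J + k)" and ?G = "\<lambda>k. G (J + k)"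
    let ?h = "\<lambda>t. ham ?\<alpha> (\<lambda>k. ?f k t)"
    have F': "fls_deriv (?F z j) = ?F z j * alt (?F z) j + fls_const (?\<alpha> j)"
      "(\<Sum>j\<in>UNIV. ?F z j) = fls_const z + fls_X" for z j
      using F(2)[of z "J + j"] F(3)[of z] by (simp_all add: alt_shift sum_shift5)
    have G': "fls_shift (-2) (fls_deriv (?G j)) = - (?G j * alt ?G j + fls_const (?\<alpha> j))"
      "(\<Sum>j\<in>UNIV. ?G j) = fls_X_inv" for j
      using G(2)[of "J + j"] G(3) by (simp_all add: alt_shift sum_shift5)
    have one': "(\<Sum>j\<in>UNIV. ?\<alpha> j) = 1" using one by (simp add: sum_shift5)
    have hrat: "rational_fun ?h" by (intro rational_fun_ham rat)
    have "\<exists>H. (\<lambda>w. ?h (z + w)) has_laurent_expansion H \<and> (\<forall>n. n < - 1 \<longrightarrow> H $$ n = 0) \<and> H $$ (-1) = pole_weight (r z) J" for z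
    proof -
      let ?H = "ham (\<lambda>j. fls_const (?\<alpha> j)) (?F z)"
      have "(\<lambda>w. ?h (z + w)) has_laurent_expansion ?H"
        by (rule ham_has_laurent_expansion) (rule F(1))
      moreover have "\<forall>n. n < - 1 \<longrightarrow> ?H $$ n = 0" using ham_residue(1)[OF F' one'] by blast
      moreover have "?H $$ (-1) = pole_weight (r z) J"
        using ham_residue(2)[OF F' one'] by (simp add: pole_weight_def r_def)
      ultimately show ?thesis by blast
    qed
    note hexp = this
    have "(\<lambda>x. ?h (inverse x)) has_laurent_expansion ham (\<lambda>j. fls_const (?\<alpha> j)) ?G"
      by (rule ham_has_laurent_expansion) (rule G(1))
    from sum_of_residues[OF hrat hexp this]
    have "ham (\<lambda>j. fls_const (?\<alpha> j)) ?G $$ 1 = (\<Sum>z | pole_weight (r z) J \<noteq> 0. pole_weight (r z) J)" .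
    moreover have "ham (\<lambda>j. fls_const (?\<alpha> j)) ?G $$ 1 = quad a b + lin ?\<alpha> (\<lambda>k. b (J + k))"
      using expansion_infinity_coefficients(6)[OF G'] quad_shift[of a J b] by (simp add: a_def b_def)
    ultimately show "quad a b + lin ?\<alpha> (\<lambda>k. b (J + k)) = (\<Sum>z | pole_weight (r z) J \<noteq> 0. pole_weight (r z) J)"
      by simp
    show "finite {z. pole_weight (r z) J \<noteq> 0}" by (rule simple_pole_expansion(1)[OF hrat hexp])
  qed
  have w: "pole_weight (r z) J = of_real (Re (pole_weight (r z) J))" "Re (pole_weight (r z) J) \<ge> 0" for z J
    using rv(2)[of z J] by auto
  have nsum: "quad a b + lin (\<lambda>k. \<alpha> (J + k)) (\<lambda>k. b (J + k)) =
      of_real (\<Sum>z | pole_weight (r z) J \<noteq> 0. Re (pole_weight (r z) J))" for J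
    unfolding n of_real_sum by (rule sum.cong) (use w in auto)
  have nonneg: "\<exists>x\<ge>0. quad a b + lin (\<lambda>k. \<alpha> (J + k)) (\<lambda>k. b (J + k)) = complex_of_real x" for J
    using nsum[of J] w(2) sum_nonneg[of "{z. pole_weight (r z) J \<noteq> 0}" "\<lambda>z. Re (pole_weight (r z) J)"] by blast
  have lin: "\<forall>j. \<forall>\<^sub>F t in cofinite. f j t = a j * t"
    if zero: "\<And>J. quad a b + lin (\<lambda>k. \<alpha> (J + k)) (\<lambda>k. b (J + k)) = 0"
  proof
    fix j
    \<comment> \<open>A vanishing sum of nonnegative weights has only zero terms, so no Hamiltonian
      has a pole and neither has the solution. The remaining polynomial has degree at most 1 and
      constant term \<open>G j $$ 0 = 0\<close>.\<close>
    have "pole_weight (r z) J = 0" for z J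
    proof (rule ccontr)
      assume nz: "pole_weight (r z) J \<noteq> 0"
      have "(\<Sum>z | pole_weight (r z) J \<noteq> 0. Re (pole_weight (r z) J)) = 0"
        using nsum[of J] zero[of J] by (metis of_real_eq_0_iff)
      then have "\<forall>z\<in>{z. pole_weight (r z) J \<noteq> 0}. Re (pole_weight (r z) J) = 0"
        using sum_nonneg_eq_0_iff[OF nfin, of J "\<lambda>z. Re (pole_weight (r z) J)"] w(2) by blast
      then show False using nz w(1)[of z J] by simp
    qed
    then have r0: "r z j = 0" for z j using rv(3) by blast
    obtain R where R: "\<forall>\<^sub>F t in cofinite. f j t = poly R t"
      using simple_pole_expansion(2)[OF rat fexp, of j] by (auto simp: r0)
    obtain P where P: "(\<lambda>x. poly R (inverse x)) has_laurent_expansion P"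
      "\<And>n. P $$ n = (if n \<le> 0 then coeff R (nat (- n)) else 0)"
      using poly_inverse_has_laurent_expansion[of R] by blast
    have "\<forall>\<^sub>F x in at 0. f j (inverse x) = poly R (inverse x)"
      using eventually_cofinite_imp_at[OF eventually_cofinite_compose_inj[OF R inj_inverse_complex]] by simp
    then have GP: "G j = P" by (rule has_laurent_expansion_eq[OF _ G(1) P(1)])
    have "coeff R k = (if k = 1 then a j else 0)" for k
    proof -
      have c: "coeff R k = G j $$ (- int k)" using P(2)[of "- int k"] by (simp add: GP)
      consider "k = 0" | "k = 1" | "- int k < -1" by linarith
      then show ?thesis
      proof cases
        case 1
        then show ?thesis using c coef(5)[of j] by simp
      next
        case 2
        then show ?thesis using c by (simp add: a_def)
      next
        case 3
        then have "coeff R k = 0" unfolding c by (rule expansion_infinity_order[OF G(2,3)])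
        with 3 show ?thesis by auto
      qed
    qed
    then have "R = monom (a j) 1" by (intro poly_eqI) simp
    then have "poly R t = a j * t" for t by (simp add: poly_monom)
    then show "\<forall>\<^sub>F t in cofinite. f j t = a j * t" using R by simp
  qed
  show ?thesis by (rule that[OF coef(1-4) bint nonneg]) (use lin in blast)
qed

section \<open>Rigidity in the fundamental alcove\<close>

text \<open>The terms cancel in pairs: A_J A_K B_m occurs once from the Hamiltonian based at J and
  once, with opposite sign, from the one based at K.\<close>

lemma weighted_lin_sum:
  fixes A B :: "5 \<Rightarrow> 'a::comm_ring_1"
  shows "(\<Sum>J\<in>UNIV. A J * lin (\<lambda>k. A (J + k)) (\<lambda>k. B (J + k))) = 0"
  by (simp add: sum5 lin_def algebra_simps)

text \<open>Averaging the five Hamiltonians with the weights $\alpha_J$ cancels their linear parts.\<close>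

lemma quad_nonneg:
  fixes A B :: "5 \<Rightarrow> real"
  assumes nonneg: "\<And>j. A j \<ge> 0" and one: "(\<Sum>j\<in>UNIV. A j) = 1"
    and n: "\<And>J. quad a B + lin (\<lambda>k. A (J + k)) (\<lambda>k. B (J + k)) \<ge> 0"
  shows "quad a B \<ge> 0"
proof -
  have "0 \<le> (\<Sum>J\<in>UNIV. A J * (quad a B + lin (\<lambda>k. A (J + k)) (\<lambda>k. B (J + k))))"
    by (intro sum_nonneg mult_nonneg_nonneg nonneg n)
  also have "\<dots> = (\<Sum>J\<in>UNIV. A J) * quad a B"
    using weighted_lin_sum[of A B] by (simp add: distrib_left sum.distrib sum_distrib_right)
  finally show ?thesis by (simp add: one)
qed

text \<open>For each type, \<open>quad a B\<close> becomes minus a sum of nonnegative terms,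
  products of parameters or squares. Being nonnegative, it vanishes, and so does each term. What
  this leaves undetermined is settled by single Hamiltonians.\<close>

lemma alcove_rigid_standard:
  fixes a A B :: "5 \<Rightarrow> real"
  assumes type: "(a 0, a 1, a 2, a 3, a 4) \<in>
      {(1,0,0,0,0), (1/3,1/3,1/3,0,0), (1,1,0,-1,0), (1/5,1/5,1/5,1/5,1/5)}"
    and nonneg: "\<And>j. A j \<ge> 0" and one: "(\<Sum>j\<in>UNIV. A j) = 1"
    and eq: "\<And>j. a j = a j * alt B j + B j * alt a j + A j" and bsum: "(\<Sum>j\<in>UNIV. B j) = 0"
    and n: "\<And>J. quad a B + lin (\<lambda>k. A (J + k)) (\<lambda>k. B (J + k)) \<ge> 0"
  shows "A j = a j \<and> B j = 0"
proof -
  have Q: "quad a B \<ge> 0" by (rule quad_nonneg[OF nonneg one n])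
  have A1: "A 0 + A 1 + A 2 + A 3 + A 4 = 1" using one by (simp add: sum5)
  have B0: "B 0 + B 1 + B 2 + B 3 + B 4 = 0" using bsum by (simp add: sum5)
  have n1: "quad a B + ((A 3 + A 0) * B 2 - A 2 * B 3 + A 0 * B 4 - (A 2 + A 4) * B 0) \<ge> 0"
    using n[of 1] by (simp add: lin_def)
  have n2: "quad a B + ((A 4 + A 1) * B 3 - A 3 * B 4 + A 1 * B 0 - (A 3 + A 0) * B 1) \<ge> 0"
    using n[of 2] by (simp add: lin_def)
  have n3: "quad a B + ((A 0 + A 2) * B 4 - A 4 * B 0 + A 2 * B 1 - (A 4 + A 1) * B 2) \<ge> 0"
    using n[of 3] by (simp add: lin_def)
  have n4: "quad a B + ((A 1 + A 3) * B 0 - A 0 * B 1 + A 3 * B 2 - (A 0 + A 2) * B 3) \<ge> 0"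
    using n[of 4] by (simp add: lin_def)
  have e: "a 0 = a 0 * (B 1 - B 2 + B 3 - B 4) + B 0 * (a 1 - a 2 + a 3 - a 4) + A 0"
    "a 1 = a 1 * (B 2 - B 3 + B 4 - B 0) + B 1 * (a 2 - a 3 + a 4 - a 0) + A 1"
    "a 2 = a 2 * (B 3 - B 4 + B 0 - B 1) + B 2 * (a 3 - a 4 + a 0 - a 1) + A 2"
    "a 3 = a 3 * (B 4 - B 0 + B 1 - B 2) + B 3 * (a 4 - a 0 + a 1 - a 2) + A 3"
    "a 4 = a 4 * (B 0 - B 1 + B 2 - B 3) + B 4 * (a 0 - a 1 + a 2 - a 3) + A 4"
    using eq[of 0] eq[of 1] eq[of 2] eq[of 3] eq[of 4] by (simp_all add: alt_def)
  note pos = nonneg[of 0] nonneg[of 1] nonneg[of 2] nonneg[of 3] nonneg[of 4]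
  have "A 0 = a 0 \<and> A 1 = a 1 \<and> A 2 = a 2 \<and> A 3 = a 3 \<and> A 4 = a 4 \<and>
      B 0 = 0 \<and> B 1 = 0 \<and> B 2 = 0 \<and> B 3 = 0 \<and> B 4 = 0"
  proof -
    from type consider
        (A) "a 0 = 1" "a 1 = 0" "a 2 = 0" "a 3 = 0" "a 4 = 0"
      | (B) "a 0 = 1/3" "a 1 = 1/3" "a 2 = 1/3" "a 3 = 0" "a 4 = 0"
      | (D) "a 0 = 1" "a 1 = 1" "a 2 = 0" "a 3 = -1" "a 4 = 0"
      | (C) "a 0 = 1/5" "a 1 = 1/5" "a 2 = 1/5" "a 3 = 1/5" "a 4 = 1/5"
      by blast
    then show ?thesis
    proof cases
      case A
      have b: "B 1 = A 1" "B 2 = - A 2" "B 3 = A 3" "B 4 = - A 4"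
        using e(2-5)[unfolded A] by simp_all
      have b0: "B 0 = A 2 + A 4 - A 1 - A 3" using B0 by (simp add: b)
      have q: "quad a B = - (A 1 * A 2 + A 1 * A 4 + A 3 * A 4)"
        by (simp add: quad_def sum5 A b algebra_simps)
      have "A 1 * A 2 \<ge> 0" "A 1 * A 4 \<ge> 0" "A 3 * A 4 \<ge> 0" using nonneg by simp_all
      with Q[unfolded q] have p: "A 1 * A 2 = 0" "A 1 * A 4 = 0" "A 3 * A 4 = 0" by linarith+
      have q0: "quad a B = 0" by (simp add: q p)
      \<comment> \<open>In each branch the parameters that survive the product relations sum to 1,
        so \<open>n1\<close> or \<open>n4\<close> reduces to minus a sum of parameters being
        nonnegative.\<close>
      have "A 1 = 0 \<and> A 2 = 0 \<and> A 3 = 0 \<and> A 4 = 0"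
      proof (cases "A 1 = 0")
        case False
        then have z: "A 2 = 0" "A 4 = 0" using p by simp_all
        have "(A 1 + A 3) * B 0 - A 0 * B 1 - A 0 * B 3 = - (A 1 + A 3) * (A 0 + A 1 + A 3)"
          by (simp add: b b0 z algebra_simps)
        moreover have "A 0 + A 1 + A 3 = 1" using A1 by (simp add: z)
        ultimately have "- (A 1 + A 3) \<ge> 0" using n4 by (simp add: q0 z b)
        with pos z show ?thesis by linarith
      next
        case a1: True
        show ?thesis
        proof (cases "A 4 = 0")
          case True
          have "(A 3 + A 0) * B 2 - A 2 * B 3 + A 0 * B 4 - (A 2 + A 4) * B 0 = - A 2 * (A 0 + A 2 + A 3)"
            by (simp add: b b0 a1 True algebra_simps)
          moreover have s: "A 0 + A 2 + A 3 = 1" using A1 by (simp add: a1 True)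
          ultimately have "- A 2 \<ge> 0" using n1 by (simp only: q0)
          moreover have "A 3 * B 0 + A 3 * B 2 - (A 0 + A 2) * B 3 = - A 3 * (A 0 + A 2 + A 3)"
            by (simp add: b b0 a1 True algebra_simps)
          then have "- A 3 \<ge> 0" using n4 s by (simp add: q0 a1 b)
          ultimately show ?thesis using pos a1 True by linarith
        next
          case False
          then have a3: "A 3 = 0" using p by simp
          have "A 0 * B 2 + A 0 * B 4 - (A 2 + A 4) * B 0 = - (A 2 + A 4) * (A 0 + A 2 + A 4)"
            by (simp add: b b0 a1 a3 algebra_simps)
          moreover have "A 0 + A 2 + A 4 = 1" using A1 by (simp add: a1 a3)
          ultimately have "- (A 2 + A 4) \<ge> 0" using n1 by (simp add: q0 a3 b)
          with pos a1 a3 show ?thesis by linarith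
        qed
      qed
      then show ?thesis using A1 A b b0 by simp
    next
      case B
      have b: "B 3 = 3 * A 3" "B 4 = - 3 * A 4" using e(4,5)[unfolded B] by simp_all
      have b0: "B 0 = - B 1 - B 2 - B 3 - B 4" using B0 by simp
      \<comment> \<open>Completed squares modulo the relation that the B_j sum to zero; the cross
        term is nonpositive because \<open>B 3 * B 4 = -9 * A 3 * A 4\<close>.\<close>
      have q: "6 * quad a B = - (B 0 + B 3)\<^sup>2 - (B 2 + B 4)\<^sup>2 - (B 1)\<^sup>2 + 2 * (B 3 * B 4)"
        by (simp add: quad_def sum5 B b0 power2_eq_square algebra_simps)
      have "B 3 * B 4 \<le> 0" using pos by (simp add: b)
      moreover have "(B 0 + B 3)\<^sup>2 \<ge> 0" "(B 2 + B 4)\<^sup>2 \<ge> 0" "(B 1)\<^sup>2 \<ge> 0" by simp_all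
      ultimately have "(B 0 + B 3)\<^sup>2 = 0" "(B 2 + B 4)\<^sup>2 = 0" "(B 1)\<^sup>2 = 0" and p: "B 3 * B 4 = 0"
        and q0: "quad a B = 0"
        using q Q by linarith+
      then have c: "B 0 = - B 3" "B 2 = - B 4" "B 1 = 0" by simp_all
      have "B 3 = 0 \<and> B 4 = 0"
      proof (cases "B 4 = 0")
        case True
        then have "A 4 = 0" using b by simp
        then have s: "A 0 + A 1 + A 2 + A 3 = 1" using A1 by simp
        have "(A 1 + A 3) * B 0 - A 0 * B 1 + A 3 * B 2 - (A 0 + A 2) * B 3 = - (A 0 + A 1 + A 2 + A 3) * B 3"
          by (simp add: c True algebra_simps)
        then have "- B 3 \<ge> 0" using n4 by (simp only: q0 s)
        then show ?thesis using True b pos by linarith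
      next
        case False
        then have z: "B 3 = 0" using p by simp
        then have "A 3 = 0" using b by simp
        then have s: "A 0 + A 1 + A 2 + A 4 = 1" using A1 by simp
        have "(A 0 + A 2) * B 4 - A 4 * B 0 + A 2 * B 1 - (A 4 + A 1) * B 2 = (A 0 + A 1 + A 2 + A 4) * B 4"
          by (simp add: c z algebra_simps)
        then have "B 4 \<ge> 0" using n3 by (simp only: q0 s)
        then show ?thesis using z b pos by linarith
      qed
      then show ?thesis using c b e(1-3)[unfolded B] B by simp
    next
      case D
      have b: "B 2 = A 2" "B 4 = - A 4" using e(3,5)[unfolded D] by simp_all
      have b13: "B 1 + B 3 = 1 - A 0 + A 2 - A 4" using e(1)[unfolded D] by (simp add: b)
      have b03: "B 0 + B 3 = A 2 - A 4 - 1 + A 1" using e(2)[unfolded D] by (simp add: b)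
      have b1: "B 1 = 1 - A 1 - 2 * A 2 + 2 * A 4" using b03 B0 b by linarith
      have b3: "B 3 = A 1 - A 0 + 3 * A 2 - 3 * A 4" using b13 b1 by linarith
      have b0: "B 0 = A 0 - 1 - 2 * A 2 + 2 * A 4" using b03 b3 by linarith
      have a0: "A 0 = 1 - A 1 - A 2 - A 3 - A 4" using A1 by linarith
      have q: "quad a B = - (A 2 * (A 0 + A 3 + A 4)) - A 4 * (A 1 + A 2 + A 3) - A 2 * A 4"
        by (simp add: quad_def sum5 D b b0 b1 b3 a0 algebra_simps)
      have "A 2 * (A 0 + A 3 + A 4) \<ge> 0" "A 4 * (A 1 + A 2 + A 3) \<ge> 0" "A 2 * A 4 \<ge> 0" using pos by simp_all
      with Q[unfolded q] have p: "A 2 * (A 0 + A 3 + A 4) = 0" "A 4 * (A 1 + A 2 + A 3) = 0" "A 2 * A 4 = 0"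
        by linarith+
      have q0: "quad a B = 0" by (simp add: q p)
      \<comment> \<open>This leading vector has a negative entry and cannot be a parameter vector of
        the alcove, so every branch has to end in a contradiction.\<close>
      have False
      proof (cases "A 2 = 0")
        case a2: True
        show False
        proof (cases "A 4 = 0")
          case a4: True
          have "(A 4 + A 1) * B 3 - A 3 * B 4 + A 1 * B 0 - (A 3 + A 0) * B 1 = A 1 - 1"
            by (simp add: b b0 b1 b3 a0 a2 a4 algebra_simps)
          then have "A 1 \<ge> 1" using n2 q0 by simp
          moreover have "(A 1 + A 3) * B 0 - A 0 * B 1 + A 3 * B 2 - (A 0 + A 2) * B 3 = - A 1 - A 3"
            by (simp add: b b0 b1 b3 a0 a2 a4 algebra_simps)
          then have "- A 1 - A 3 \<ge> 0" using n4 q0 by simp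
          ultimately show False using pos by linarith
        next
          case False
          then have "A 1 + A 2 + A 3 = 0" using p by simp
          then have z: "A 1 = 0" "A 3 = 0" using pos by linarith+
          have "(A 4 + A 1) * B 3 - A 3 * B 4 + A 1 * B 0 - (A 3 + A 0) * B 1 = - 1 - 2 * A 4"
            by (simp add: b b0 b1 b3 a0 a2 z algebra_simps)
          then show False using n2 q0 pos by simp
        qed
      next
        case False
        then have "A 0 + A 3 + A 4 = 0" using p by simp
        then have z: "A 0 = 0" "A 3 = 0" "A 4 = 0" using pos by linarith+
        then have a1: "A 1 = 1 - A 2" using A1 by simp
        have "(A 1 + A 3) * B 0 - A 0 * B 1 + A 3 * B 2 - (A 0 + A 2) * B 3 = - 1 - 2 * A 2"
          by (simp add: b b0 b1 b3 a1 z algebra_simps)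
        then show False using n4 q0 pos by simp
      qed
      then show ?thesis ..
    next
      case C
      have b0: "B 0 = - B 1 - B 2 - B 3 - B 4" using B0 by simp
      \<comment> \<open>Modulo the zero sum, \<open>quad\<close> is a negative multiple of \<Sum>
        (B_j + B_(j+2))^2, which is definite since steps of 2 form one cycle of odd length.\<close>
      have q: "10 * quad a B = - ((B 0 + B 2)\<^sup>2 + (B 1 + B 3)\<^sup>2 + (B 2 + B 4)\<^sup>2 + (B 3 + B 0)\<^sup>2 + (B 4 + B 1)\<^sup>2)"
        by (simp add: quad_def sum5 C b0 power2_eq_square algebra_simps)
      have sq: "(B 0 + B 2)\<^sup>2 \<ge> 0" "(B 1 + B 3)\<^sup>2 \<ge> 0" "(B 2 + B 4)\<^sup>2 \<ge> 0" "(B 3 + B 0)\<^sup>2 \<ge> 0" "(B 4 + B 1)\<^sup>2 \<ge> 0"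
        by simp_all
      have "(B 0 + B 2)\<^sup>2 = 0" "(B 1 + B 3)\<^sup>2 = 0" "(B 2 + B 4)\<^sup>2 = 0" "(B 3 + B 0)\<^sup>2 = 0" "(B 4 + B 1)\<^sup>2 = 0"
        using q Q sq by linarith+
      then have "B 0 + B 2 = 0" "B 1 + B 3 = 0" "B 2 + B 4 = 0" "B 3 + B 0 = 0" "B 4 + B 1 = 0" by simp_all
      then have z: "B 0 = 0" "B 1 = 0" "B 2 = 0" "B 3 = 0" "B 4 = 0" by linarith+
      then show ?thesis using e[unfolded C z] C by simp
    qed
  qed
  then show ?thesis using index5_cases[of j] by auto
qed

text \<open>All data are real here: a by the list of types, b because it is integral, \<alpha> by
  assumption. So the real rigidity statement applies to real parts, after rotating a to standard
  position.\<close>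

lemma alcove_solution:
  assumes sol: "rat_solution \<alpha> f" and one: "(\<Sum>j\<in>UNIV. \<alpha> j) = 1"
    and nonneg: "\<And>j. \<exists>x\<ge>0. \<alpha> j = complex_of_real x"
  shows "\<exists>i. (\<alpha> i, \<alpha> (i+1), \<alpha> (i+2), \<alpha> (i+3), \<alpha> (i+4)) \<in>
      {(1,0,0,0,0), (1/3,1/3,1/3,0,0), (1/5,1/5,1/5,1/5,1/5)}"
    and "\<forall>j. \<forall>\<^sub>F t in cofinite. f j t = \<alpha> j * t"
proof -
  obtain a b where ab: "\<And>j. a j * alt a j = 0" "(\<Sum>j\<in>UNIV. a j) = 1"
    "\<And>j. a j = a j * alt b j + b j * alt a j + \<alpha> j" "(\<Sum>j\<in>UNIV. b j) = 0"
    "\<And>j. b j \<in> \<int>"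
    "\<And>J. \<exists>x\<ge>0. quad a b + lin (\<lambda>k. \<alpha> (J + k)) (\<lambda>k. b (J + k)) = complex_of_real x"
    "(\<forall>J. quad a b + lin (\<lambda>k. \<alpha> (J + k)) (\<lambda>k. b (J + k)) = 0) \<longrightarrow>
      (\<forall>j. \<forall>\<^sub>F t in cofinite. f j t = a j * t)"
    by (rule solution_asymptotics[OF sol one]) (rule that; assumption)
  obtain i where i: "(a i, a (i+1), a (i+2), a (i+3), a (i+4)) \<in>
      {(1,0,0,0,0), (1/3,1/3,1/3,0,0), (1,1,0,-1,0), (1/5,1/5,1/5,1/5,1/5)}"
    using leading_vector[of a, OF ab(1,2)] by (elim exE)
  define a' A B where "a' k = Re (a (i + k))" and "A k = Re (\<alpha> (i + k))" and "B k = Re (b (i + k))" for k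
  have r3: "x \<in> \<real>" if "x * 3 = 1" for x :: complex
  proof -
    have "x = of_real (1/3)" using that by (simp add: field_simps)
    then show ?thesis by (simp only: Reals_of_real)
  qed
  have r5: "x \<in> \<real>" if "x * 5 = 1" for x :: complex
  proof -
    have "x = of_real (1/5)" using that by (simp add: field_simps)
    then show ?thesis by (simp only: Reals_of_real)
  qed
  have "\<forall>k. a (i + k) \<in> \<real>" unfolding all5 using i by (auto intro: r3 r5)
  then have ra: "a (i + k) = of_real (a' k)" for k by (simp add: a'_def)
  have rA: "\<alpha> (i + k) = of_real (A k)" and A0: "A k \<ge> 0" for k
    using nonneg[of "i + k"] by (auto simp: A_def)
  have rB: "b (i + k) = of_real (B k)" for k
    using ab(5)[of "i + k"] by (auto simp: B_def Ints_def)
  have A1: "(\<Sum>j\<in>UNIV. A j) = 1"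
  proof -
    have "complex_of_real (\<Sum>j\<in>UNIV. A j) = 1" using one sum_shift5[of \<alpha> i] by (simp add: rA)
    then show ?thesis by (metis of_real_eq_1_iff)
  qed
  have B0: "(\<Sum>j\<in>UNIV. B j) = 0"
  proof -
    have "complex_of_real (\<Sum>j\<in>UNIV. B j) = 0" using ab(4) sum_shift5[of b i] by (simp add: rB)
    then show ?thesis by (metis of_real_eq_0_iff)
  qed
  have eq: "a' j = a' j * alt B j + B j * alt a' j + A j" for j
  proof -
    have "complex_of_real (a' j) = of_real (a' j * alt B j + B j * alt a' j + A j)"
      using ab(3)[of "i + j"] by (simp add: alt_shift[symmetric] ra rA rB) (simp add: alt_def)
    then show ?thesis by (simp only: of_real_eq_iff)
  qed
  have quad: "quad a b = of_real (quad a' B)"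
    using quad_shift[of a i b] by (simp add: ra rB) (simp add: quad_def)
  have lin: "lin (\<lambda>k. \<alpha> (i + J + k)) (\<lambda>k. b (i + J + k)) = of_real (lin (\<lambda>k. A (J + k)) (\<lambda>k. B (J + k)))" for J
    by (simp add: lin_def add.assoc rA rB)
  have n: "quad a' B + lin (\<lambda>k. A (J + k)) (\<lambda>k. B (J + k)) \<ge> 0" for J
  proof -
    obtain x where "x \<ge> 0" "complex_of_real (quad a' B + lin (\<lambda>k. A (J + k)) (\<lambda>k. B (J + k))) = of_real x"
      using ab(6)[of "i + J"] by (auto simp: quad lin)
    then show ?thesis by (simp only: of_real_eq_iff)
  qed
  have t: "(a' 0, a' 1, a' 2, a' 3, a' 4) \<in>
      {(1,0,0,0,0), (1/3,1/3,1/3,0,0), (1,1,0,-1,0), (1/5,1/5,1/5,1/5,1/5)}"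
    using imageI[OF i, of "\<lambda>(x0,x1,x2,x3,x4). (Re x0, Re x1, Re x2, Re x3, Re x4)"] by (simp add: a'_def)
  have rigid: "A j = a' j \<and> B j = 0" for j
    by (rule alcove_rigid_standard[OF t A0 A1 eq B0 n])
  have "\<alpha> (i + k) = a (i + k)" "b (i + k) = 0" for k
    using rigid[of k] by (simp_all add: ra rA rB)
  from this[of "j - i" for j] have \<alpha>: "\<alpha> j = a j" and b: "b j = 0" for j by simp_all
  have "a (i+3) \<noteq> -1" using A0[of 3] rigid[of 3] by (auto simp: a'_def)
  then show "\<exists>i. (\<alpha> i, \<alpha> (i+1), \<alpha> (i+2), \<alpha> (i+3), \<alpha> (i+4)) \<in>
      {(1,0,0,0,0), (1/3,1/3,1/3,0,0), (1/5,1/5,1/5,1/5,1/5)}"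
    using i unfolding \<alpha> by blast
  have "quad a b + lin (\<lambda>k. \<alpha> (J + k)) (\<lambda>k. b (J + k)) = 0" for J
    by (simp add: quad_def lin_def b)
  then have "\<forall>j. \<forall>\<^sub>F t in cofinite. f j t = a j * t" using ab(7) by blast
  then show "\<forall>j. \<forall>\<^sub>F t in cofinite. f j t = \<alpha> j * t" by (simp add: \<alpha>)
qed

section \<open>Backlund transformations\<close>

text \<open>Polymorphic, because the same reflection acts on complex parameters, on the integer
  vectors 15\<alpha> and on representatives modulo 3 or 5.\<close>

definition s_par :: "5 \<Rightarrow> (5 \<Rightarrow> 'a::ab_group_add) \<Rightarrow> 5 \<Rightarrow> 'a" where
  "s_par i \<alpha> = (\<lambda>k. if k = i then - \<alpha> i else if k = i + 1 \<or> k = i - 1 then \<alpha> k + \<alpha> i else \<alpha> k)"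

definition s_fun :: "5 \<Rightarrow> (5 \<Rightarrow> complex) \<Rightarrow> (5 \<Rightarrow> complex \<Rightarrow> complex) \<Rightarrow> 5 \<Rightarrow> complex \<Rightarrow> complex" where
  "s_fun i \<alpha> f = (\<lambda>k t. if k = i + 1 then f k t + \<alpha> i / f i t
     else if k = i - 1 then f k t - \<alpha> i / f i t else f k t)"

lemma bt_act_S:
  "\<not> (\<forall>\<^sub>F t in cofinite. f i t = 0) \<Longrightarrow> bt_act (S i) (\<alpha>, f) = (s_par i \<alpha>, s_fun i \<alpha> f)"
  unfolding bt_act.simps s_par_def s_fun_def by (rule if_not_P)

lemma pred5: "(i::5) - 1 = i + 4"
  by (simp add: diff_eq_eq add.assoc)

lemma s_par_index:
  "s_par i \<alpha> i = - \<alpha> i" "s_par i \<alpha> (i+1) = \<alpha> (i+1) + \<alpha> i" "s_par i \<alpha> (i+2) = \<alpha> (i+2)"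
  "s_par i \<alpha> (i+3) = \<alpha> (i+3)" "s_par i \<alpha> (i+4) = \<alpha> (i+4) + \<alpha> i"
  by (simp_all add: s_par_def pred5)

lemma s_fun_index:
  "s_fun i \<alpha> f i = f i" "s_fun i \<alpha> f (i+1) = (\<lambda>t. f (i+1) t + \<alpha> i / f i t)" "s_fun i \<alpha> f (i+2) = f (i+2)"
  "s_fun i \<alpha> f (i+3) = f (i+3)" "s_fun i \<alpha> f (i+4) = (\<lambda>t. f (i+4) t - \<alpha> i / f i t)"
  by (simp_all add: s_fun_def pred5)

lemma A4_rhs_index:
  "A4_rhs \<alpha> f i t = f i t * (f (i+1) t - f (i+2) t + f (i+3) t - f (i+4) t) + \<alpha> i"
  "A4_rhs \<alpha> f (i+1) t = f (i+1) t * (f (i+2) t - f (i+3) t + f (i+4) t - f i t) + \<alpha> (i+1)"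
  "A4_rhs \<alpha> f (i+2) t = f (i+2) t * (f (i+3) t - f (i+4) t + f i t - f (i+1) t) + \<alpha> (i+2)"
  "A4_rhs \<alpha> f (i+3) t = f (i+3) t * (f (i+4) t - f i t + f (i+1) t - f (i+2) t) + \<alpha> (i+3)"
  "A4_rhs \<alpha> f (i+4) t = f (i+4) t * (f i t - f (i+1) t + f (i+2) t - f (i+3) t) + \<alpha> (i+4)"
  by (simp_all add: A4_rhs_def add.assoc)

lemma all5_shift: "(\<forall>j. P j) \<longleftrightarrow> P i \<and> P (i+1) \<and> P (i+2) \<and> P (i+3) \<and> P (i+4)" for P :: "5 \<Rightarrow> bool"
  using shift5_left[of P i] all5[of "\<lambda>j. P (i + j)"] by simp

lemma sum5_shift: "(\<Sum>j\<in>UNIV. g j) = g i + g (i+1) + g (i+2) + g (i+3) + g (i+4)" for i :: 5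
  using sum_shift5[of g i] by (simp add: sum5)

lemma s_par_sum: "(\<Sum>j\<in>UNIV. s_par i \<alpha> j) = (\<Sum>j\<in>UNIV. \<alpha> j)"
  unfolding sum5_shift[of _ i] s_par_index by simp

lemma s_par_involution: "s_par i (s_par i \<alpha>) = \<alpha>"
proof -
  have "\<forall>j. s_par i (s_par i \<alpha>) j = \<alpha> j"
    unfolding all5_shift[of _ i] s_par_index by simp
  then show ?thesis by blast
qed

text \<open>The equation for f_i reduces to 0 = \<alpha>_i. By contraposition, \<alpha>_i \<noteq> 0
  guarantees that s_i acts by its formula.\<close>

lemma solution_zero_component:
  assumes sol: "rat_solution \<alpha> f" and zero: "\<forall>\<^sub>F t in cofinite. f i t = 0"
  shows "\<alpha> i = 0"
proof -
  have fin: "finite {t. f i t \<noteq> 0}" using zero by (simp add: eventually_cofinite)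
  have "\<forall>\<^sub>F t in cofinite. (f i has_field_derivative A4_rhs \<alpha> f i t) (at t) \<and> f i t = 0"
    using sol zero unfolding rat_solution_def by (auto elim: eventually_elim2)
  then have "finite {t. \<not> ((f i has_field_derivative A4_rhs \<alpha> f i t) (at t) \<and> f i t = 0)}"
    by (simp add: eventually_cofinite)
  then obtain t where t: "(f i has_field_derivative A4_rhs \<alpha> f i t) (at t)" "f i t = 0"
    using ex_new_if_finite[OF infinite_UNIV_char_0] by blast
  have op: "open (- {t. f i t \<noteq> 0})" using fin by (intro open_Compl finite_imp_closed)
  have "(f i has_field_derivative 0) (at t)"
    by (rule has_field_derivative_transform_within_open[OF DERIV_const op]) (simp_all add: t(2))
  then have "A4_rhs \<alpha> f i t = 0" using t(1) DERIV_unique by blast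
  then show ?thesis using t(2) by (simp add: A4_rhs_def)
qed

lemma s_fun_solution:
  assumes sol: "rat_solution \<alpha> f" and nz: "\<not> (\<forall>\<^sub>F t in cofinite. f i t = 0)"
  shows "rat_solution (s_par i \<alpha>) (s_fun i \<alpha> f)"
proof -
  have rat: "\<And>j. rational_fun (f j)"
    and ev: "\<forall>\<^sub>F t in cofinite. (\<Sum>j\<in>UNIV. f j t) = t \<and> (\<forall>j. (f j has_field_derivative A4_rhs \<alpha> f j t) (at t))"
    using sol unfolding rat_solution_def by blast+
  have "\<forall>\<^sub>F t in cofinite. f i t \<noteq> 0" using rational_fun_zero_or_nonzero[OF rat] nz by blast
  with ev have "\<forall>\<^sub>F t in cofinite. (\<Sum>j\<in>UNIV. s_fun i \<alpha> f j t) = t \<and>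
      (\<forall>j. (s_fun i \<alpha> f j has_field_derivative A4_rhs (s_par i \<alpha>) (s_fun i \<alpha> f) j t) (at t))"
  proof eventually_elim
    case (elim t)
    then have nz: "f i t \<noteq> 0" and s: "(\<Sum>j\<in>UNIV. f j t) = t"
      and d: "\<And>j. (f j has_field_derivative A4_rhs \<alpha> f j t) (at t)" by blast+
    have "(\<Sum>j\<in>UNIV. s_fun i \<alpha> f j t) = t"
      using s unfolding sum5_shift[of _ i] s_fun_index by (simp add: add.assoc)
    moreover have q: "((\<lambda>t. \<alpha> i / f i t) has_field_derivative - \<alpha> i * A4_rhs \<alpha> f i t / (f i t * f i t)) (at t)"
      using DERIV_divide[OF DERIV_const d[of i] nz, of "\<alpha> i"] by simp
    have "\<forall>j. (s_fun i \<alpha> f j has_field_derivative A4_rhs (s_par i \<alpha>) (s_fun i \<alpha> f) j t) (at t)"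
      unfolding all5_shift[of _ i] s_fun_index
    proof (intro conjI)
      show "(f i has_field_derivative A4_rhs (s_par i \<alpha>) (s_fun i \<alpha> f) i t) (at t)"
        by (rule DERIV_cong[OF d], unfold A4_rhs_index[of _ _ i] s_fun_index s_par_index) (use nz in \<open>simp add: field_simps\<close>)
      show "((\<lambda>t. f (i+1) t + \<alpha> i / f i t) has_field_derivative A4_rhs (s_par i \<alpha>) (s_fun i \<alpha> f) (i+1) t) (at t)"
        by (rule DERIV_cong[OF DERIV_add[OF d q]], unfold A4_rhs_index[of _ _ i] s_fun_index s_par_index)
          (use nz in \<open>simp add: field_simps\<close>)
      show "(f (i+2) has_field_derivative A4_rhs (s_par i \<alpha>) (s_fun i \<alpha> f) (i+2) t) (at t)"
        by (rule DERIV_cong[OF d], unfold A4_rhs_index[of _ _ i] s_fun_index s_par_index)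
          (use nz in \<open>simp add: field_simps\<close>)
      show "(f (i+3) has_field_derivative A4_rhs (s_par i \<alpha>) (s_fun i \<alpha> f) (i+3) t) (at t)"
        by (rule DERIV_cong[OF d], unfold A4_rhs_index[of _ _ i] s_fun_index s_par_index)
          (use nz in \<open>simp add: field_simps\<close>)
      show "((\<lambda>t. f (i+4) t - \<alpha> i / f i t) has_field_derivative A4_rhs (s_par i \<alpha>) (s_fun i \<alpha> f) (i+4) t) (at t)"
        by (rule DERIV_cong[OF DERIV_diff[OF d q]], unfold A4_rhs_index[of _ _ i] s_fun_index s_par_index)
          (use nz in \<open>simp add: field_simps\<close>)
    qed
    ultimately show ?case by blast
  qed
  moreover have "\<forall>j. rational_fun (s_fun i \<alpha> f j)"
    unfolding all5_shift[of _ i] s_fun_index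
    by (intro conjI rat rational_fun_add rational_fun_diff rational_fun_divide rational_fun_const)
  ultimately show ?thesis unfolding rat_solution_def by blast
qed

text \<open>s_i leaves f_i alone, so the corrections \<alpha>_i/f_i on both sides agree and can be
  subtracted.\<close>

lemma s_fun_cancel:
  assumes same: "same_ratfun (s_fun i \<alpha> f) (s_fun i \<alpha> g)"
  shows "same_ratfun f g"
proof -
  have same': "\<forall>\<^sub>F t in cofinite. s_fun i \<alpha> f j t = s_fun i \<alpha> g j t" for j
    using same unfolding same_ratfun_def by blast
  note ev = same'[of i, unfolded s_fun_index] same'[of "i+1", unfolded s_fun_index]
    same'[of "i+2", unfolded s_fun_index] same'[of "i+3", unfolded s_fun_index] same'[of "i+4", unfolded s_fun_index]
  have "\<forall>\<^sub>F t in cofinite. f (i+1) t = g (i+1) t" using ev(1,2) by eventually_elim simp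
  moreover have "\<forall>\<^sub>F t in cofinite. f (i+4) t = g (i+4) t" using ev(1,5) by eventually_elim simp
  ultimately show ?thesis
    unfolding same_ratfun_def all5_shift[of _ i] using ev(1,3,4) by blast
qed

section \<open>Descent to the alcove\<close>

text \<open>
  For $m = 15\alpha$ this is the sum of the squares of all differences of the partial sums of $m_j - 3$, that is,
  up to scaling, the squared distance of $\alpha$ to the barycentre $\frac15(1,1,1,1,1)$ of the alcove.
\<close>

definition height :: "(5 \<Rightarrow> int) \<Rightarrow> int" where
  "height m = (\<Sum>j\<in>UNIV. (m j - 3)\<^sup>2 + (m j + m (j+1) - 6)\<^sup>2)"

text \<open>Squared distances from a point and from its mirror image to the barycentre differ by
  four times the product of the distances to the mirror, here m_i/sqrt 2 and 3/sqrt 2. Summing over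
  pairs multiplies the norm by 5, hence 4 (3/2) 5 = 30.\<close>

lemma height_s_par:
  assumes sum: "(\<Sum>j\<in>UNIV. m j) = 15"
  shows "height (s_par i m) = height m + 30 * m i"
proof -
  have s: "m (i+4) = 15 - m i - m (i+1) - m (i+2) - m (i+3)"
    using sum unfolding sum5_shift[of _ i] by simp
  show ?thesis
    unfolding height_def sum5_shift[of _ i]
    by (simp add: add.assoc s_par_index s) (simp add: power2_eq_square algebra_simps)
qed

text \<open>The descent as an induction rule: a property is proved in the alcove and pulled back
  through one reflection at a time. The step offers \<alpha>_i \<noteq> 0, which is what makes s_i
  act on solutions by its formula.\<close>

lemma alcove_induct:
  assumes "\<And>j. 15 * \<alpha> j \<in> \<int>" "(\<Sum>j\<in>UNIV. \<alpha> j) = 1"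
    and base: "\<And>\<alpha>. (\<And>j. 15 * \<alpha> j \<in> \<int>) \<Longrightarrow> (\<Sum>j\<in>UNIV. \<alpha> j) = 1 \<Longrightarrow>
      (\<And>j. \<exists>x\<ge>0. \<alpha> j = complex_of_real x) \<Longrightarrow> P \<alpha>"
    and step: "\<And>\<alpha> i. (\<And>j. 15 * \<alpha> j \<in> \<int>) \<Longrightarrow> (\<Sum>j\<in>UNIV. \<alpha> j) = 1 \<Longrightarrow> \<alpha> i \<noteq> 0 \<Longrightarrow>
      P (s_par i \<alpha>) \<Longrightarrow> P \<alpha>"
  shows "P \<alpha>"
proof -
  have "\<forall>j. \<exists>n. 15 * \<alpha> j = of_int n" using assms(1) by (blast elim: Ints_cases)
  from choice[OF this] obtain m where "\<And>j. 15 * \<alpha> j = of_int (m j)" by blast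
  then show ?thesis using assms(2)
  proof (induction "nat (height m)" arbitrary: m \<alpha> rule: less_induct)
    case less
    have \<alpha>: "\<alpha> j = of_int (m j) / 15" for j using less.prems(1)[of j] by (simp add: field_simps)
    have int: "15 * \<alpha> j \<in> \<int>" for j by (simp add: less.prems(1))
    show ?case
    proof (cases "\<forall>j. m j \<ge> 0")
      case True
      have "\<exists>x\<ge>0. \<alpha> j = complex_of_real x" for j
        using True by (intro exI[of _ "real_of_int (m j) / 15"]) (simp add: \<alpha>)
      then show ?thesis using base int less.prems(2) by blast
    next
      case False
      then obtain i where i: "m i < 0" by (auto simp: not_le)
      have "of_int (\<Sum>j\<in>UNIV. m j) = (\<Sum>j\<in>UNIV. 15 * \<alpha> j)" by (simp add: less.prems(1))
      also have "\<dots> = of_int 15" by (simp add: sum_distrib_left[symmetric] less.prems(2))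
      finally have sum: "(\<Sum>j\<in>UNIV. m j) = 15" by (simp only: of_int_eq_iff)
      have h: "height (s_par i m) = height m + 30 * m i" by (rule height_s_par[OF sum])
      have "height (s_par i m) \<ge> 0" unfolding height_def by (intro sum_nonneg) simp
      then have "nat (height (s_par i m)) < nat (height m)" using h i by simp
      moreover have "15 * s_par i \<alpha> j = of_int (s_par i m j)" for j
        by (simp add: s_par_def less.prems(1) distrib_left)
      moreover have "(\<Sum>j\<in>UNIV. s_par i \<alpha> j) = 1" using less.prems(2) by (simp add: s_par_sum)
      ultimately have "P (s_par i \<alpha>)" by (rule less.hyps)
      moreover have "\<alpha> i \<noteq> 0" using i by (simp add: \<alpha>)
      ultimately show ?thesis using step[of \<alpha> i] int less.prems(2) by blast
    qed
  qed
qed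

text \<open>Solving the equation of order zero at infinity for \<alpha> gives terms linear in a with
  integer coefficients built from b, so 15 clears the denominators 3 and 5 of a.\<close>

lemma solution_parameters:
  assumes sol: "rat_solution \<alpha> f" and one: "(\<Sum>j\<in>UNIV. \<alpha> j) = 1"
  shows "15 * \<alpha> j \<in> \<int>"
proof -
  obtain a b where ab: "\<And>j. a j * alt a j = 0" "(\<Sum>j\<in>UNIV. a j) = 1"
    "\<And>j. a j = a j * alt b j + b j * alt a j + \<alpha> j" "\<And>j. b j \<in> \<int>"
    by (rule solution_asymptotics[OF sol one]) (rule that; assumption)
  obtain i where i: "(a i, a (i+1), a (i+2), a (i+3), a (i+4)) \<in>
      {(1,0,0,0,0), (1/3,1/3,1/3,0,0), (1,1,0,-1,0), (1/5,1/5,1/5,1/5,1/5)}"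
    using leading_vector[of a, OF ab(1,2)] by (elim exE)
  have r3: "15 * x \<in> \<int>" if "x * 3 = 1" for x :: complex
  proof -
    have "15 * x = 5 * (x * 3)" by simp
    also have "\<dots> = 5" by (simp only: that mult_1_right)
    finally show ?thesis by (simp only: Ints_numeral)
  qed
  have r5: "15 * x \<in> \<int>" if "x * 5 = 1" for x :: complex
  proof -
    have "15 * x = 3 * (x * 5)" by simp
    also have "\<dots> = 3" by (simp only: that mult_1_right)
    finally show ?thesis by (simp only: Ints_numeral)
  qed
  have "\<forall>j. 15 * a j \<in> \<int>" unfolding all5_shift[of _ i] using i by (auto intro: r3 r5)
  then have a: "15 * a j \<in> \<int>" for j by blast
  have alta: "15 * alt a j \<in> \<int>" for j
    unfolding alt_def by (simp add: distrib_left right_diff_distrib a)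
  have altb: "alt b j \<in> \<int>" for j
    unfolding alt_def by (simp add: ab(4))
  have \<alpha>: "\<alpha> j = a j - a j * alt b j - b j * alt a j" using ab(3)[of j] by (simp add: algebra_simps)
  have eq: "15 * \<alpha> j = 15 * a j - (15 * a j) * alt b j - b j * (15 * alt a j)"
    unfolding \<alpha> by (simp add: algebra_simps)
  show ?thesis unfolding eq by (intro Ints_diff Ints_mult a alta altb ab(4))
qed

section \<open>Invariance of the parameter conditions\<close>

text \<open>Reads a list as a function on Z/5Z, so that \<open>s_par\<close> and cyclic shifts apply
  to the vectors of the conditions.\<close>

definition vec5 :: "'a list \<Rightarrow> 5 \<Rightarrow> 'a" where
  "vec5 v j = (if j = 0 then v ! 0 else if j = 1 then v ! 1 else if j = 2 then v ! 2 else if j = 3 then v ! 3 else v ! 4)"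

lemma shift_cong_iff: "shift_cong \<alpha> i c v \<longleftrightarrow> (\<forall>k. \<alpha> (i + k) - c * vec5 v k \<in> \<int>)"
proof -
  have all_less: "(\<forall>k<5. P k) \<longleftrightarrow> P 0 \<and> P 1 \<and> P 2 \<and> P 3 \<and> P 4" for P :: "nat \<Rightarrow> bool"
  proof -
    have "k < 5 \<longleftrightarrow> k = 0 \<or> k = 1 \<or> k = 2 \<or> k = 3 \<or> k = 4" for k :: nat by auto
    then show ?thesis by auto
  qed
  show ?thesis unfolding shift_cong_def all5 all_less by (simp add: vec5_def)
qed

lemma vec5_map: "length v = 5 \<Longrightarrow> vec5 (map g v) k = g (vec5 v k)"
  by (simp add: vec5_def)

lemma reflect_mod_3:
  fixes w :: "int list"
  assumes "w \<in> {[1,1,1,0,0], [1,-1,-1,1,0]}"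
  shows "\<exists>i s w'. s \<in> {1,-1} \<and> w' \<in> {[1,1,1,0,0], [1,-1,-1,1,0]} \<and>
    (\<forall>k. 3 dvd s_par m (vec5 w) (i + k) - s * vec5 w' k)"
proof -
  define P where "P m w i s w' \<longleftrightarrow> s \<in> {1,-1} \<and> w' \<in> {[1,1,1,0,0], [1,-1,-1,1,0]} \<and>
    (\<forall>k. 3 dvd s_par m (vec5 w) (i + k) - s * vec5 w' k)" for m i :: 5 and w w' :: "int list" and s :: int
  \<comment> \<open>The table of reflections: for each position m and listed vector, the rotation,
    sign and vector that describe its image modulo 3.\<close>
  have "P 0 [1,1,1,0,0] 4 (1) [1,-1,-1,1,0]"
    "P 1 [1,1,1,0,0] 0 (-1) [1,1,1,0,0]"
    "P 2 [1,1,1,0,0] 0 (1) [1,-1,-1,1,0]"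
    "P 3 [1,1,1,0,0] 0 (1) [1,1,1,0,0]"
    "P 4 [1,1,1,0,0] 0 (1) [1,1,1,0,0]"
    "P 0 [1,-1,-1,1,0] 2 (-1) [1,-1,-1,1,0]"
    "P 1 [1,-1,-1,1,0] 1 (1) [1,1,1,0,0]"
    "P 2 [1,-1,-1,1,0] 0 (1) [1,1,1,0,0]"
    "P 3 [1,-1,-1,1,0] 3 (-1) [1,-1,-1,1,0]"
    "P 4 [1,-1,-1,1,0] 0 (1) [1,-1,-1,1,0]"
    by (simp_all add: P_def all5 s_par_def vec5_def)
  with assms index5_cases[of m] have "\<exists>i s w'. P m w i s w'" by (elim insertE emptyE disjE) blast+
  then show ?thesis unfolding P_def .
qed

lemma reflect_mod_5:
  fixes w :: "int list"
  assumes "w \<in> {[1,1,1,1,1], [1,2,1,3,3]}"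
  shows "\<exists>i s w'. s \<in> {1,2,3,4} \<and> w' \<in> {[1,1,1,1,1], [1,2,1,3,3]} \<and>
    (\<forall>k. 5 dvd s_par m (vec5 w) (i + k) - s * vec5 w' k)"
proof -
  define P where "P m w i s w' \<longleftrightarrow> s \<in> {1,2,3,4} \<and> w' \<in> {[1,1,1,1,1], [1,2,1,3,3]} \<and>
    (\<forall>k. 5 dvd s_par m (vec5 w) (i + k) - s * vec5 w' k)" for m i :: 5 and w w' :: "int list" and s :: int
  \<comment> \<open>The same table modulo 5, where a unit multiplier replaces the sign.\<close>
  have "P 0 [1,1,1,1,1] 4 (2) [1,2,1,3,3]"
    "P 1 [1,1,1,1,1] 0 (2) [1,2,1,3,3]"
    "P 2 [1,1,1,1,1] 1 (2) [1,2,1,3,3]"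
    "P 3 [1,1,1,1,1] 2 (2) [1,2,1,3,3]"
    "P 4 [1,1,1,1,1] 3 (2) [1,2,1,3,3]"
    "P 0 [1,2,1,3,3] 1 (3) [1,2,1,3,3]"
    "P 1 [1,2,1,3,3] 0 (3) [1,1,1,1,1]"
    "P 2 [1,2,1,3,3] 4 (3) [1,2,1,3,3]"
    "P 3 [1,2,1,3,3] 1 (2) [1,2,1,3,3]"
    "P 4 [1,2,1,3,3] 4 (2) [1,2,1,3,3]"
    by (simp_all add: P_def all5 s_par_def vec5_def)
  with assms index5_cases[of m] have "\<exists>i s w'. P m w i s w'" by (elim insertE emptyE disjE) blast+
  then show ?thesis unfolding P_def .
qed

text \<open>\<open>s_par\<close> is additive, so \<alpha> congruent to c w goes to c times the
  reflected w, with the position counted from i. As N c is an integer, the reflected w may be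
  replaced modulo N, and the multiplier s moves into c.\<close>

lemma shift_cong_s_par:
  assumes \<alpha>: "shift_cong \<alpha> i c (map of_int w)" and len: "length w = 5" "length w' = 5"
    and N: "of_int N * c \<in> \<int>" and dvd: "\<And>k. N dvd s_par m (vec5 w) (i' + k) - s * vec5 w' k"
  shows "shift_cong (s_par (i + m) \<alpha>) (i + i') (c * of_int s) (map of_int w')"
  unfolding shift_cong_iff
proof
  fix k
  have a: "\<alpha> (i + j) - c * of_int (vec5 w j) \<in> \<int>" for j
    using \<alpha> by (simp add: shift_cong_iff vec5_map len)
  have am: "\<alpha> (i + j) + \<alpha> (i + m) - c * (of_int (vec5 w j) + of_int (vec5 w m)) \<in> \<int>" for j
    using Ints_add[OF a[of j] a[of m]] by (simp add: algebra_simps)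
  have an: "- \<alpha> (i + m) + c * of_int (vec5 w m) \<in> \<int>"
    using Ints_minus[OF a[of m]] by simp
  have 1: "s_par (i + m) \<alpha> (i + j) - c * of_int (s_par m (vec5 w) j) \<in> \<int>" for j
    using a[of j] am[of j] an by (simp add: s_par_def add.assoc add_diff_eq[symmetric])
  obtain n where n: "s_par m (vec5 w) (i' + k) - s * vec5 w' k = N * n" using dvd[of k] by (elim dvdE)
  have "c * of_int (s_par m (vec5 w) (i' + k)) - c * of_int s * of_int (vec5 w' k) = of_int N * c * of_int n"
  proof -
    have "s_par m (vec5 w) (i' + k) = s * vec5 w' k + N * n" using n by simp
    then show ?thesis by (simp add: algebra_simps)
  qed
  also have "\<dots> \<in> \<int>" by (rule Ints_mult[OF N]) simp
  finally have 2: "c * of_int (s_par m (vec5 w) (i' + k)) - c * of_int s * of_int (vec5 w' k) \<in> \<int>" .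
  show "s_par (i + m) \<alpha> (i + i' + k) - c * of_int s * vec5 (map of_int w') k \<in> \<int>"
    using Ints_add[OF 1[of "i' + k"] 2] by (simp add: vec5_map len add.assoc)
qed

lemma cond1_s_par: "cond1 \<alpha> \<Longrightarrow> cond1 (s_par l \<alpha>)"
  by (simp add: cond1_def s_par_def)

lemma cond2_s_par:
  assumes "cond2 \<alpha>"
  shows "cond2 (s_par l \<alpha>)"
proof -
  have c2: "cond2 \<beta> \<longleftrightarrow> (\<exists>i. \<exists>c\<in>{1/3, -1/3}. \<exists>w\<in>{[1,1,1,0,0], [1,-1,-1,1,0]}. shift_cong \<beta> i c (map of_int w))" for \<beta>
    by (simp add: cond2_def)
  obtain i c w where c: "c \<in> {1/3, -1/3}" and w: "w \<in> {[1,1,1,0,0], [1,-1,-1,1,0]}"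
    and \<alpha>: "shift_cong \<alpha> i c (map of_int w)"
    using assms unfolding c2 by blast
  obtain i' s w' where s: "s \<in> {1,-1}" and w': "w' \<in> {[1,1,1,0,0], [1,-1,-1,1,0]}"
    and d: "\<forall>k. 3 dvd s_par (l - i) (vec5 w) (i' + k) - s * vec5 w' k"
    using reflect_mod_3[OF w, of "l - i"] by blast
  have len: "length w = 5" "length w' = 5" using w w' by auto
  have "of_int 3 * c \<in> \<int>" using c by (elim insertE emptyE; hypsubst; simp)
  from shift_cong_s_par[OF \<alpha> len this d[rule_format]]
  have "shift_cong (s_par l \<alpha>) (i + i') (c * of_int s) (map of_int w')" by simp
  moreover have "c * of_int s \<in> {1/3, -1/3}" using c s by (elim insertE emptyE; hypsubst; simp)
  ultimately show ?thesis unfolding c2 using w' by blast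
qed

lemma cond3_s_par:
  assumes "cond3 \<alpha>"
  shows "cond3 (s_par l \<alpha>)"
proof -
  have c3: "cond3 \<beta> \<longleftrightarrow> (\<exists>i. \<exists>j::nat\<in>{1..4}. \<exists>w\<in>{[1,1,1,1,1], [1,2,1,3,3]}. shift_cong \<beta> i (of_nat j / 5) (map of_int w))" for \<beta>
    by (simp add: cond3_def)
  obtain i j w where j: "j \<in> {1..4::nat}" and w: "w \<in> {[1,1,1,1,1], [1,2,1,3,3]}"
    and \<alpha>: "shift_cong \<alpha> i (of_nat j / 5) (map of_int w)"
    using assms unfolding c3 by blast
  obtain i' s w' where s: "s \<in> {1,2,3,4}" and w': "w' \<in> {[1,1,1,1,1], [1,2,1,3,3]}"
    and d: "\<forall>k. 5 dvd s_par (l - i) (vec5 w) (i' + k) - s * vec5 w' k"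
    using reflect_mod_5[OF w, of "l - i"] by blast
  have len: "length w = 5" "length w' = 5" using w w' by auto
  have "of_int 5 * (of_nat j / 5) \<in> (\<int> :: complex set)" by simp
  from shift_cong_s_par[OF \<alpha> len this d[rule_format]]
  have sc: "shift_cong (s_par l \<alpha>) (i + i') (of_nat j / 5 * of_int s) (map of_int w')" by simp
  \<comment> \<open>\<open>cond3\<close> admits only multipliers 1 to 4, so the product is reduced
    modulo 5; it is nonzero there because 5 is prime.\<close>
  define j' where "j' = nat ((int j * s) mod 5)"
  have "j \<in> {1,2,3,4}" using j by auto
  then have j': "j' \<in> {1..4}" using s by (auto simp: j'_def)
  have "int j * s = 5 * ((int j * s) div 5) + int j'" by (simp add: j'_def)
  then have "complex_of_int (int j * s) = of_int (5 * ((int j * s) div 5) + int j')" by (simp only:)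
  then have e: "complex_of_nat j / 5 * of_int s = of_int ((int j * s) div 5) + of_nat j' / 5"
    by (simp add: field_simps)
  have "shift_cong (s_par l \<alpha>) (i + i') (of_nat j' / 5) (map of_int w')"
    unfolding shift_cong_iff
  proof
    fix k
    have "s_par l \<alpha> (i + i' + k) - of_nat j / 5 * of_int s * of_int (vec5 w' k) \<in> \<int>"
      using sc by (simp add: shift_cong_iff vec5_map len)
    then have "s_par l \<alpha> (i + i' + k) - of_nat j / 5 * of_int s * of_int (vec5 w' k)
        + of_int ((int j * s) div 5 * vec5 w' k) \<in> \<int>"
      by (rule Ints_add) simp
    then show "s_par l \<alpha> (i + i' + k) - of_nat j' / 5 * vec5 (map of_int w') k \<in> \<int>"
      unfolding e by (simp add: vec5_map len algebra_simps)
  qed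
  then show ?thesis unfolding c3 using w' j' by blast
qed

section \<open>Parameters in the alcove\<close>

text \<open>For f = a t the quadratic terms vanish, and f' = a shows that a is its own parameter
  vector.\<close>

lemma linear_solution:
  assumes hom: "\<And>j. a j * alt a j = 0" and sum: "(\<Sum>j\<in>UNIV. a j) = 1"
  shows "rat_solution a (\<lambda>j t. a j * t)"
proof -
  have "A4_rhs a (\<lambda>j t. a j * t) j t = a j" for j t
  proof -
    have "A4_rhs a (\<lambda>j t. a j * t) j t = a j * alt a j * t * t + a j"
      by (simp add: A4_rhs_def alt_def algebra_simps)
    then show ?thesis by (simp add: hom)
  qed
  moreover have "((\<lambda>t. a j * t) has_field_derivative a j) (at t)" for j t
    by (rule DERIV_cmult_Id)
  moreover have "(\<Sum>j\<in>UNIV. a j * t) = t" for t by (simp add: sum_distrib_right[symmetric] sum)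
  moreover have "rational_fun (\<lambda>t. a j * t)" for j by (rule rational_fun_cmult[OF rational_fun_ident])
  ultimately show ?thesis unfolding rat_solution_def by simp
qed

lemma seed_homogeneous:
  fixes \<alpha> :: "5 \<Rightarrow> complex"
  assumes "(\<alpha> i, \<alpha> (i+1), \<alpha> (i+2), \<alpha> (i+3), \<alpha> (i+4)) \<in> {(c,0,0,0,0), (c,c,c,0,0), (c,c,c,c,c)}"
  shows "\<alpha> j * alt \<alpha> j = 0"
proof -
  have "\<forall>j. \<alpha> j * alt \<alpha> j = 0"
    unfolding all5_shift[of _ i] alt_def using assms by (auto simp: add.assoc)
  then show ?thesis ..
qed

lemma alcove_cond1:
  assumes "cond1 \<alpha>" "(\<Sum>j\<in>UNIV. \<alpha> j) = 1" "\<And>j. \<exists>x\<ge>0. \<alpha> j = complex_of_real x"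
  shows "\<exists>i. (\<alpha> i, \<alpha> (i+1), \<alpha> (i+2), \<alpha> (i+3), \<alpha> (i+4)) = (1,0,0,0,0)"
proof -
  have "\<exists>n\<ge>0. \<alpha> j = of_int n" for j
  proof -
    obtain x where x: "x \<ge> 0" "\<alpha> j = complex_of_real x" using assms(3) by blast
    obtain n where n: "\<alpha> j = of_int n" using assms(1) unfolding cond1_def by (meson Ints_cases)
    have "x = of_int n" using x(2) n by (metis of_real_eq_iff of_real_of_int_eq)
    then show ?thesis using x n by auto
  qed
  then obtain n where n: "\<And>j. n j \<ge> 0" "\<And>j. \<alpha> j = of_int (n j)" by metis
  have "of_int (\<Sum>j\<in>UNIV. n j) = (of_int 1 :: complex)" using assms(2) by (simp add: n(2))
  then have s: "(\<Sum>j\<in>UNIV. n j) = 1" by (simp only: of_int_eq_iff)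
  have "\<exists>i. n i \<noteq> 0"
  proof (rule ccontr)
    assume "\<not> (\<exists>i. n i \<noteq> 0)"
    then show False using s by simp
  qed
  then obtain i where i: "n i \<noteq> 0" by blast
  have "n i = 1 \<and> n (i+1) = 0 \<and> n (i+2) = 0 \<and> n (i+3) = 0 \<and> n (i+4) = 0"
    using s i n(1)[of i] n(1)[of "i+1"] n(1)[of "i+2"] n(1)[of "i+3"] n(1)[of "i+4"]
    unfolding sum5_shift[of _ i] by linarith
  then show ?thesis by (intro exI[of _ i]) (simp add: n(2))
qed

text \<open>In the alcove a congruence condition becomes a finite problem: nonnegative integers with
  prescribed residues modulo q and total q.\<close>

lemma shift_cong_numerators:
  assumes sc: "shift_cong \<alpha> i (of_int p / of_nat q) (map of_int w)" and len: "length w = 5" and q: "q > 0"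
    and one: "(\<Sum>j\<in>UNIV. \<alpha> j) = 1" and nonneg: "\<And>j. \<exists>x\<ge>0. \<alpha> j = complex_of_real x"
  obtains n where "\<And>k. \<alpha> (i + k) = of_int (p * vec5 w k + int q * n k) / of_nat q"
    "\<And>k. p * vec5 w k + int q * n k \<ge> 0" "(\<Sum>k\<in>UNIV. p * vec5 w k + int q * n k) = int q"
proof -
  have "\<alpha> (i + k) - of_int p / of_nat q * of_int (vec5 w k) \<in> \<int>" for k
    using sc by (simp add: shift_cong_iff vec5_map len)
  then have "\<forall>k. \<exists>n. \<alpha> (i + k) - of_int p / of_nat q * of_int (vec5 w k) = of_int n"
    by (blast elim: Ints_cases)
  from choice[OF this] obtain n
    where n: "\<And>k. \<alpha> (i + k) - of_int p / of_nat q * of_int (vec5 w k) = of_int (n k)" by blast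
  have 1: "\<alpha> (i + k) = of_int (p * vec5 w k + int q * n k) / of_nat q" for k
  proof -
    have "\<alpha> (i + k) = of_int p / of_nat q * of_int (vec5 w k) + of_int (n k)" using n[of k] by (simp add: algebra_simps)
    then show ?thesis using q by (simp add: field_simps)
  qed
  have 2: "p * vec5 w k + int q * n k \<ge> 0" for k
  proof -
    obtain x where x: "x \<ge> 0" "\<alpha> (i + k) = complex_of_real x" using nonneg by blast
    have "complex_of_real x = complex_of_real (of_int (p * vec5 w k + int q * n k) / of_nat q)"
      using x(2) 1[of k] by simp
    then have "x = of_int (p * vec5 w k + int q * n k) / of_nat q" by (simp only: of_real_eq_iff)
    with x(1) q have "real_of_int (p * vec5 w k + int q * n k) \<ge> 0" by (simp add: zero_le_divide_iff)
    then show ?thesis by (simp only: of_int_0_le_iff)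
  qed
  have "(\<Sum>k\<in>UNIV. \<alpha> (i + k)) = 1" using one by (simp add: sum_shift5)
  then have "(\<Sum>k\<in>UNIV. complex_of_int (p * vec5 w k + int q * n k)) / of_nat q = 1"
    unfolding 1 by (simp only: sum_divide_distrib)
  then have "complex_of_int (\<Sum>k\<in>UNIV. p * vec5 w k + int q * n k) = of_int (int q)"
    using q by (simp add: field_simps)
  then have 3: "(\<Sum>k\<in>UNIV. p * vec5 w k + int q * n k) = int q" by (simp only: of_int_eq_iff)
  show ?thesis using that[OF 1 2 3] .
qed

lemma alcove_cond2:
  assumes c2: "cond2 \<alpha>" and one: "(\<Sum>j\<in>UNIV. \<alpha> j) = 1" and nonneg: "\<And>j. \<exists>x\<ge>0. \<alpha> j = complex_of_real x"
  shows "\<exists>i. (\<alpha> i, \<alpha> (i+1), \<alpha> (i+2), \<alpha> (i+3), \<alpha> (i+4)) = (1/3,1/3,1/3,0,0)"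
proof -
  have "\<exists>i. \<exists>p\<in>{1,-1}. \<exists>w\<in>{[1,1,1,0,0], [1,-1,-1,1,0]}. shift_cong \<alpha> i (of_int p / of_nat 3) (map of_int w)"
    using c2 by (simp add: cond2_def)
  then obtain i p w where p: "p \<in> {1,-1}" and w: "w \<in> {[1,1,1,0,0], [1,-1,-1,1,0]}"
    and sc: "shift_cong \<alpha> i (of_int p / of_nat 3) (map of_int w)" by blast
  have "length w = 5" using w by auto
  then obtain n where n: "\<And>k. \<alpha> (i + k) = of_int (p * vec5 w k + int 3 * n k) / of_nat 3"
    "\<And>k. p * vec5 w k + int 3 * n k \<ge> 0" "(\<Sum>k\<in>UNIV. p * vec5 w k + int 3 * n k) = int 3"
    by (rule shift_cong_numerators[OF sc _ _ one nonneg]) simp_all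
  have s: "p * vec5 w 0 + 3 * n 0 + (p * vec5 w 1 + 3 * n 1) + (p * vec5 w 2 + 3 * n 2)
      + (p * vec5 w 3 + 3 * n 3) + (p * vec5 w 4 + 3 * n 4) = 3"
    using n(3) by (simp add: sum5)
  have g: "p * vec5 w 0 + 3 * n 0 \<ge> 0" "p * vec5 w 1 + 3 * n 1 \<ge> 0" "p * vec5 w 2 + 3 * n 2 \<ge> 0"
    "p * vec5 w 3 + 3 * n 3 \<ge> 0" "p * vec5 w 4 + 3 * n 4 \<ge> 0"
    using n(2)[of 0] n(2)[of 1] n(2)[of 2] n(2)[of 3] n(2)[of 4] by simp_all
  \<comment> \<open>The least nonnegative residues modulo 3 already sum to 6 > 3 in the other three
    cases; here they sum to 3, so every numerator is minimal.\<close>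
  have "p = 1 \<and> w = [1,1,1,0,0] \<and> n 0 = 0 \<and> n 1 = 0 \<and> n 2 = 0 \<and> n 3 = 0 \<and> n 4 = 0"
    using p w
  proof (elim insertE emptyE)
    assume pw: "p = 1" "w = [1,1,1,0,0]"
    show ?thesis using s g unfolding pw by (simp add: vec5_def; presburger)
  next
    assume pw: "p = 1" "w = [1,-1,-1,1,0]"
    have False using s g unfolding pw by (simp add: vec5_def; presburger)
    then show ?thesis ..
  next
    assume pw: "p = -1" "w = [1,1,1,0,0]"
    have False using s g unfolding pw by (simp add: vec5_def; presburger)
    then show ?thesis ..
  next
    assume pw: "p = -1" "w = [1,-1,-1,1,0]"
    have False using s g unfolding pw by (simp add: vec5_def; presburger)
    then show ?thesis ..
  qed
  then show ?thesis using n(1)[of 0] n(1)[of 1] n(1)[of 2] n(1)[of 3] n(1)[of 4]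
    by (intro exI[of _ i]) (simp add: vec5_def)
qed

lemma alcove_cond3:
  assumes c3: "cond3 \<alpha>" and one: "(\<Sum>j\<in>UNIV. \<alpha> j) = 1" and nonneg: "\<And>j. \<exists>x\<ge>0. \<alpha> j = complex_of_real x"
  shows "\<exists>i. (\<alpha> i, \<alpha> (i+1), \<alpha> (i+2), \<alpha> (i+3), \<alpha> (i+4)) = (1/5,1/5,1/5,1/5,1/5)"
proof -
  have "\<exists>i. \<exists>j::nat\<in>{1..4}. \<exists>w\<in>{[1,1,1,1,1], [1,2,1,3,3]}. shift_cong \<alpha> i (of_int (int j) / of_nat 5) (map of_int w)"
    using c3 by (simp add: cond3_def)
  then obtain i and j :: nat and w where j: "j \<in> {1..4}" and w: "w \<in> {[1,1,1,1,1], [1,2,1,3,3]}"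
    and sc: "shift_cong \<alpha> i (of_int (int j) / of_nat 5) (map of_int w)" by blast
  define p where "p = int j"
  have p: "p = 1 \<or> p = 2 \<or> p = 3 \<or> p = 4" using j by (auto simp: p_def)
  have "length w = 5" using w by auto
  then obtain n where n: "\<And>k. \<alpha> (i + k) = of_int (p * vec5 w k + int 5 * n k) / of_nat 5"
    "\<And>k. p * vec5 w k + int 5 * n k \<ge> 0" "(\<Sum>k\<in>UNIV. p * vec5 w k + int 5 * n k) = int 5"
    by (rule shift_cong_numerators[OF sc[folded p_def] _ _ one nonneg]) simp_all
  have s: "p * vec5 w 0 + 5 * n 0 + (p * vec5 w 1 + 5 * n 1) + (p * vec5 w 2 + 5 * n 2)
      + (p * vec5 w 3 + 5 * n 3) + (p * vec5 w 4 + 5 * n 4) = 5"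
    using n(3) by (simp add: sum5)
  have g: "p * vec5 w 0 + 5 * n 0 \<ge> 0" "p * vec5 w 1 + 5 * n 1 \<ge> 0" "p * vec5 w 2 + 5 * n 2 \<ge> 0"
    "p * vec5 w 3 + 5 * n 3 \<ge> 0" "p * vec5 w 4 + 5 * n 4 \<ge> 0"
    using n(2)[of 0] n(2)[of 1] n(2)[of 2] n(2)[of 3] n(2)[of 4] by simp_all
  \<comment> \<open>Gives \<open>n k \<ge> - (p * vec5 w k div 5)\<close>: each numerator is at
    least its residue modulo 5. These residues sum to at least 10, except for \<open>p = 1\<close>
    and the vector of ones, where they sum to 5.\<close>
  have floor: "- m \<le> x div 5" if "0 \<le> x + 5 * m" for x m :: int using that by presburger
  note lower = g[THEN floor]
  have "w = [1,1,1,1,1] \<and> p = 1 \<and> n 0 = 0 \<and> n 1 = 0 \<and> n 2 = 0 \<and> n 3 = 0 \<and> n 4 = 0"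
    using w p
  proof (elim insertE emptyE disjE)
    assume wp: "w = [1,1,1,1,1]" "p = 1"
    show ?thesis using s lower unfolding wp by (simp add: vec5_def)
  qed (use s lower in \<open>simp_all add: vec5_def\<close>)
  then have "w = [1,1,1,1,1]" and v: "p * vec5 w 0 + int 5 * n 0 = 1" "p * vec5 w 1 + int 5 * n 1 = 1"
    "p * vec5 w 2 + int 5 * n 2 = 1" "p * vec5 w 3 + int 5 * n 3 = 1" "p * vec5 w 4 + int 5 * n 4 = 1"
    by (simp_all add: vec5_def)
  then show ?thesis using n(1)[of 0] n(1)[of 1] n(1)[of 2] n(1)[of 3] n(1)[of 4] unfolding v
    by (intro exI[of _ i]) simp
qed

section \<open>The classification\<close>

lemma shift_cong_denominator:
  assumes sc: "shift_cong \<alpha> i c (map of_int w)" and len: "length w = 5" and c: "15 * c \<in> \<int>"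
  shows "15 * \<alpha> j \<in> \<int>"
proof -
  have "\<alpha> (i + (j - i)) - c * of_int (vec5 w (j - i)) \<in> \<int>"
    using sc unfolding shift_cong_iff vec5_map[OF len] by blast
  then have 1: "15 * (\<alpha> j - c * of_int (vec5 w (j - i))) \<in> \<int>" by (intro Ints_mult) simp_all
  have 2: "15 * c * of_int (vec5 w (j - i)) \<in> \<int>" by (rule Ints_mult[OF c]) simp
  show ?thesis using Ints_add[OF 1 2] by (simp add: algebra_simps)
qed

text \<open>Supplies the integrality that starts the descent when no solution is given yet.\<close>

lemma cond_denominator:
  assumes "cond1 \<alpha> \<or> cond2 \<alpha> \<or> cond3 \<alpha>"
  shows "15 * \<alpha> j \<in> \<int>"
  using assms
proof (elim disjE)
  assume "cond1 \<alpha>"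
  then show ?thesis unfolding cond1_def by (intro Ints_mult) simp_all
next
  assume "cond2 \<alpha>"
  then have "\<exists>i. \<exists>c\<in>{1/3, -1/3}. \<exists>w\<in>{[1,1,1,0,0], [1,-1,-1,1,0]}. shift_cong \<alpha> i c (map of_int w)"
    by (simp add: cond2_def)
  then obtain i c w where c: "c \<in> {1/3, -1/3}" and w: "w \<in> {[1,1,1,0,0], [1,-1,-1,1,0]}"
    and sc: "shift_cong \<alpha> i c (map of_int w)" by blast
  have "15 * c \<in> \<int>" using c by (elim insertE emptyE; hypsubst; simp)
  moreover have "length w = 5" using w by auto
  ultimately show ?thesis using shift_cong_denominator[OF sc] by blast
next
  assume "cond3 \<alpha>"
  then have "\<exists>i. \<exists>j::nat\<in>{1..4}. \<exists>w\<in>{[1,1,1,1,1], [1,2,1,3,3]}. shift_cong \<alpha> i (of_nat j / 5) (map of_int w)"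
    by (simp add: cond3_def)
  then obtain i and k :: nat and w where w: "w \<in> {[1,1,1,1,1], [1,2,1,3,3]}"
    and sc: "shift_cong \<alpha> i (of_nat k / 5) (map of_int w)" by blast
  have "15 * (of_nat k / 5) = (of_nat (3 * k) :: complex)" by simp
  then have "15 * (of_nat k / 5) \<in> (\<int> :: complex set)" by (simp only: Ints_of_nat)
  moreover have "length w = 5" using w by auto
  ultimately show ?thesis using shift_cong_denominator[OF sc] by blast
qed

lemma solution_nonzero_component:
  "rat_solution \<alpha> f \<Longrightarrow> \<alpha> i \<noteq> 0 \<Longrightarrow> \<not> (\<forall>\<^sub>F t in cofinite. f i t = 0)"
  using solution_zero_component by blast

lemma s_fun_solution_if_nonzero:
  "rat_solution \<alpha> f \<Longrightarrow> \<alpha> i \<noteq> 0 \<Longrightarrow> rat_solution (s_par i \<alpha>) (s_fun i \<alpha> f)"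
  by (rule s_fun_solution[OF _ solution_nonzero_component])

text \<open>In the alcove the conditions leave only rotated seeds, which have linear solutions; a
  solution at \<open>s_par i \<alpha>\<close> is reflected back by the involution.\<close>

lemma cond_imp_solution:
  assumes "(\<Sum>j\<in>UNIV. \<alpha> j) = 1" "cond1 \<alpha> \<or> cond2 \<alpha> \<or> cond3 \<alpha>"
  shows "\<exists>f. rat_solution \<alpha> f"
proof -
  have "cond1 \<alpha> \<or> cond2 \<alpha> \<or> cond3 \<alpha> \<longrightarrow> (\<exists>f. rat_solution \<alpha> f)"
  proof (rule alcove_induct[OF cond_denominator[OF assms(2)] assms(1)])
    fix \<alpha> :: "5 \<Rightarrow> complex"
    assume one: "(\<Sum>j\<in>UNIV. \<alpha> j) = 1" and nonneg: "\<And>j. \<exists>x\<ge>0. \<alpha> j = complex_of_real x"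
    show "cond1 \<alpha> \<or> cond2 \<alpha> \<or> cond3 \<alpha> \<longrightarrow> (\<exists>f. rat_solution \<alpha> f)"
    proof
      assume "cond1 \<alpha> \<or> cond2 \<alpha> \<or> cond3 \<alpha>"
      then obtain i c where ic: "(\<alpha> i, \<alpha> (i+1), \<alpha> (i+2), \<alpha> (i+3), \<alpha> (i+4)) \<in> {(c,0,0,0,0), (c,c,c,0,0), (c,c,c,c,c)}"
        using alcove_cond1[OF _ one nonneg] alcove_cond2[OF _ one nonneg] alcove_cond3[OF _ one nonneg] by blast
      show "\<exists>f. rat_solution \<alpha> f" using linear_solution[OF seed_homogeneous[OF ic] one] by blast
    qed
  next
    fix \<alpha> :: "5 \<Rightarrow> complex" and i
    assume nz: "\<alpha> i \<noteq> 0"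
      and IH: "cond1 (s_par i \<alpha>) \<or> cond2 (s_par i \<alpha>) \<or> cond3 (s_par i \<alpha>) \<longrightarrow> (\<exists>f. rat_solution (s_par i \<alpha>) f)"
    show "cond1 \<alpha> \<or> cond2 \<alpha> \<or> cond3 \<alpha> \<longrightarrow> (\<exists>f. rat_solution \<alpha> f)"
    proof
      assume "cond1 \<alpha> \<or> cond2 \<alpha> \<or> cond3 \<alpha>"
      then obtain f where f: "rat_solution (s_par i \<alpha>) f"
        using IH cond1_s_par cond2_s_par cond3_s_par by blast
      moreover have "s_par i \<alpha> i \<noteq> 0" using nz by (simp add: s_par_index)
      ultimately have "rat_solution (s_par i (s_par i \<alpha>)) (s_fun i (s_par i \<alpha>) f)"
        by (rule s_fun_solution_if_nonzero)
      then show "\<exists>f. rat_solution \<alpha> f" unfolding s_par_involution by blast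
    qed
  qed
  then show ?thesis using assms(2) by blast
qed

lemma solution_imp_cond:
  assumes one: "(\<Sum>j\<in>UNIV. \<alpha> j) = 1" and sol: "rat_solution \<alpha> f"
  shows "cond1 \<alpha> \<or> cond2 \<alpha> \<or> cond3 \<alpha>"
proof -
  have "\<forall>f. rat_solution \<alpha> f \<longrightarrow> cond1 \<alpha> \<or> cond2 \<alpha> \<or> cond3 \<alpha>"
  proof (rule alcove_induct[OF solution_parameters[OF sol one] one], intro allI impI)
    fix \<alpha> :: "5 \<Rightarrow> complex" and f
    assume one: "(\<Sum>j\<in>UNIV. \<alpha> j) = 1" and nonneg: "\<And>j. \<exists>x\<ge>0. \<alpha> j = complex_of_real x"
      and sol: "rat_solution \<alpha> f"
    obtain i where "(\<alpha> i, \<alpha> (i+1), \<alpha> (i+2), \<alpha> (i+3), \<alpha> (i+4)) \<in>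
        {(1,0,0,0,0), (1/3,1/3,1/3,0,0), (1/5,1/5,1/5,1/5,1/5)}"
      using alcove_solution(1)[OF sol one nonneg] by (elim exE)
    then consider "(\<alpha> i, \<alpha> (i+1), \<alpha> (i+2), \<alpha> (i+3), \<alpha> (i+4)) = (1,0,0,0,0)"
      | "(\<alpha> i, \<alpha> (i+1), \<alpha> (i+2), \<alpha> (i+3), \<alpha> (i+4)) = (1/3,1/3,1/3,0,0)"
      | "(\<alpha> i, \<alpha> (i+1), \<alpha> (i+2), \<alpha> (i+3), \<alpha> (i+4)) = (1/5,1/5,1/5,1/5,1/5)"
      by (elim insertE emptyE)
    then show "cond1 \<alpha> \<or> cond2 \<alpha> \<or> cond3 \<alpha>"
    proof cases
      case 1
      then have "cond1 \<alpha>" unfolding cond1_def all5_shift[of _ i] by simp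
      then show ?thesis by blast
    next
      case 2
      then have v: "\<alpha> i = 1/3" "\<alpha> (i+1) = 1/3" "\<alpha> (i+2) = 1/3" "\<alpha> (i+3) = 0" "\<alpha> (i+4) = 0" by blast+
      have "\<forall>k. \<alpha> (i + k) - 1/3 * vec5 [1,1,1,0,0] k \<in> \<int>"
        unfolding all5 by (simp add: v vec5_def)
      then have "cond2 \<alpha>" unfolding cond2_def shift_cong_iff by blast
      then show ?thesis by blast
    next
      case 3
      then have v: "\<alpha> i = 1/5" "\<alpha> (i+1) = 1/5" "\<alpha> (i+2) = 1/5" "\<alpha> (i+3) = 1/5" "\<alpha> (i+4) = 1/5" by blast+
      have "\<forall>k. \<alpha> (i + k) - of_nat 1 / 5 * vec5 [1,1,1,1,1] k \<in> \<int>"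
        unfolding all5 by (simp add: v vec5_def)
      moreover have "(1::nat) \<in> {1..4}" by simp
      ultimately have "cond3 \<alpha>" unfolding cond3_def shift_cong_iff by blast
      then show ?thesis by blast
    qed
  next
    fix \<alpha> :: "5 \<Rightarrow> complex" and i
    assume nz: "\<alpha> i \<noteq> 0"
      and IH: "\<forall>f. rat_solution (s_par i \<alpha>) f \<longrightarrow> cond1 (s_par i \<alpha>) \<or> cond2 (s_par i \<alpha>) \<or> cond3 (s_par i \<alpha>)"
    show "\<forall>f. rat_solution \<alpha> f \<longrightarrow> cond1 \<alpha> \<or> cond2 \<alpha> \<or> cond3 \<alpha>"
    proof (intro allI impI)
      fix f assume "rat_solution \<alpha> f"
      then have "rat_solution (s_par i \<alpha>) (s_fun i \<alpha> f)"
        using nz by (rule s_fun_solution_if_nonzero)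
      with IH show "cond1 \<alpha> \<or> cond2 \<alpha> \<or> cond3 \<alpha>"
        using cond1_s_par[of "s_par i \<alpha>" i] cond2_s_par[of "s_par i \<alpha>" i] cond3_s_par[of "s_par i \<alpha>" i]
        unfolding s_par_involution by blast
    qed
  qed
  then show ?thesis using sol by blast
qed

lemma solution_unique:
  assumes one: "(\<Sum>j\<in>UNIV. \<alpha> j) = 1" and sol: "rat_solution \<alpha> f" "rat_solution \<alpha> g"
  shows "same_ratfun f g"
proof -
  have "\<forall>f g. rat_solution \<alpha> f \<and> rat_solution \<alpha> g \<longrightarrow> same_ratfun f g"
  proof (rule alcove_induct[OF solution_parameters[OF sol(1) one] one], intro allI impI)
    fix \<alpha> :: "5 \<Rightarrow> complex" and f g
    assume one: "(\<Sum>j\<in>UNIV. \<alpha> j) = 1" and nonneg: "\<And>j. \<exists>x\<ge>0. \<alpha> j = complex_of_real x"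
      and sol: "rat_solution \<alpha> f \<and> rat_solution \<alpha> g"
    have "\<forall>\<^sub>F t in cofinite. f j t = g j t" for j
    proof -
      have "\<forall>\<^sub>F t in cofinite. f j t = \<alpha> j * t" "\<forall>\<^sub>F t in cofinite. g j t = \<alpha> j * t"
        using alcove_solution(2)[OF _ one nonneg] sol by blast+
      then show ?thesis by eventually_elim simp
    qed
    then show "same_ratfun f g" unfolding same_ratfun_def by blast
  next
    fix \<alpha> :: "5 \<Rightarrow> complex" and i
    assume nz: "\<alpha> i \<noteq> 0"
      and IH: "\<forall>f g. rat_solution (s_par i \<alpha>) f \<and> rat_solution (s_par i \<alpha>) g \<longrightarrow> same_ratfun f g"
    show "\<forall>f g. rat_solution \<alpha> f \<and> rat_solution \<alpha> g \<longrightarrow> same_ratfun f g"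
    proof (intro allI impI, elim conjE)
      fix f g assume sol: "rat_solution \<alpha> f" "rat_solution \<alpha> g"
      have "rat_solution (s_par i \<alpha>) (s_fun i \<alpha> f)"
        by (rule s_fun_solution_if_nonzero[OF sol(1) nz])
      moreover have "rat_solution (s_par i \<alpha>) (s_fun i \<alpha> g)"
        by (rule s_fun_solution_if_nonzero[OF sol(2) nz])
      ultimately have "same_ratfun (s_fun i \<alpha> f) (s_fun i \<alpha> g)" using IH by blast
      then show "same_ratfun f g" by (rule s_fun_cancel)
    qed
  qed
  then show ?thesis using sol by blast
qed

text \<open>\<open>fold\<close> applies the head of the word first, so a reflection made before a
  given word is put in front of it.\<close>

lemma bt_reaches_S:
  assumes "rat_solution \<alpha> f" "\<alpha> i \<noteq> 0" "bt_reaches (s_par i \<alpha>) (s_fun i \<alpha> f) \<beta> g"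
  shows "bt_reaches \<alpha> f \<beta> g"
proof -
  obtain ws where ws: "fst (bt_word ws (s_par i \<alpha>, s_fun i \<alpha> f)) = \<beta>"
    "same_ratfun (snd (bt_word ws (s_par i \<alpha>, s_fun i \<alpha> f))) g"
    using assms(3) unfolding bt_reaches_def by blast
  have "bt_word (S i # ws) (\<alpha>, f) = bt_word ws (s_par i \<alpha>, s_fun i \<alpha> f)"
    unfolding bt_word_def fold_simps(2) bt_act_S[of f i \<alpha>, OF solution_nonzero_component[OF assms(1,2)]] ..
  then show ?thesis using ws unfolding bt_reaches_def by (intro exI[of _ "S i # ws"]) simp
qed

lemma bt_word_Pi:
  "bt_word (replicate n gen.Pi) (\<alpha>, f) = ((\<lambda>j. \<alpha> (of_nat n + j)), (\<lambda>j. f (of_nat n + j)))"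
proof (induction n arbitrary: \<alpha> f)
  case 0
  then show ?case by (simp add: bt_word_def)
next
  case (Suc n)
  have "bt_word (replicate (Suc n) gen.Pi) (\<alpha>, f) =
      bt_word (replicate n gen.Pi) ((\<lambda>j. \<alpha> (j + 1)), (\<lambda>j. f (j + 1)))"
    by (simp add: bt_word_def)
  then show ?case unfolding Suc.IH by (simp add: ac_simps)
qed

lemma alcove_reaches:
  assumes sol: "rat_solution \<alpha> f" and one: "(\<Sum>j\<in>UNIV. \<alpha> j) = 1"
    and nonneg: "\<And>j. \<exists>x\<ge>0. \<alpha> j = complex_of_real x" and \<beta>: "\<forall>j. \<alpha> (i + j) = \<beta> j"
  shows "bt_reaches \<alpha> f \<beta> (\<lambda>j t. \<beta> j * t)"
proof -
  \<comment> \<open>Words contain no inverse of \<open>Pi\<close>, so the rotation by i is written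
    as a natural power.\<close>
  obtain n :: nat where n: "i = of_nat n"
    using index5_cases[of i] by (metis of_nat_0 of_nat_1 of_nat_numeral)
  have "same_ratfun (\<lambda>j. f (i + j)) (\<lambda>j t. \<beta> j * t)"
    using alcove_solution(2)[OF sol one nonneg] \<beta> unfolding same_ratfun_def by metis
  moreover have "(\<lambda>j. \<alpha> (i + j)) = \<beta>" using \<beta> by blast
  ultimately show ?thesis unfolding bt_reaches_def n
    by (intro exI[of _ "replicate n gen.Pi"]) (simp add: bt_word_Pi)
qed

text \<open>Stated for an arbitrary class C, so that the three normal forms share one descent: C is
  stable under reflections, and its only alcove point up to rotation is the seed \<beta>.\<close>

lemma cond_reaches:
  assumes one: "(\<Sum>j\<in>UNIV. \<alpha> j) = 1" and sol: "rat_solution \<alpha> f" and C: "C \<alpha>"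
    and alcove: "\<And>\<alpha>. C \<alpha> \<Longrightarrow> (\<Sum>j\<in>UNIV. \<alpha> j) = 1 \<Longrightarrow> (\<And>j. \<exists>x\<ge>0. \<alpha> j = complex_of_real x) \<Longrightarrow>
      \<exists>i. \<forall>j. \<alpha> (i + j) = \<beta> j"
    and refl: "\<And>\<alpha> i. C \<alpha> \<Longrightarrow> C (s_par i \<alpha>)"
  shows "bt_reaches \<alpha> f \<beta> (\<lambda>j t. \<beta> j * t)"
proof -
  have "\<forall>f. rat_solution \<alpha> f \<and> C \<alpha> \<longrightarrow> bt_reaches \<alpha> f \<beta> (\<lambda>j t. \<beta> j * t)"
  proof (rule alcove_induct[OF solution_parameters[OF sol one] one], intro allI impI)
    fix \<alpha> :: "5 \<Rightarrow> complex" and f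
    assume one: "(\<Sum>j\<in>UNIV. \<alpha> j) = 1" and nonneg: "\<And>j. \<exists>x\<ge>0. \<alpha> j = complex_of_real x"
      and sol: "rat_solution \<alpha> f \<and> C \<alpha>"
    obtain i where "\<forall>j. \<alpha> (i + j) = \<beta> j" using alcove[OF _ one nonneg] sol by blast
    then show "bt_reaches \<alpha> f \<beta> (\<lambda>j t. \<beta> j * t)" using alcove_reaches[OF _ one nonneg] sol by blast
  next
    fix \<alpha> :: "5 \<Rightarrow> complex" and i
    assume nz: "\<alpha> i \<noteq> 0"
      and IH: "\<forall>f. rat_solution (s_par i \<alpha>) f \<and> C (s_par i \<alpha>) \<longrightarrow> bt_reaches (s_par i \<alpha>) f \<beta> (\<lambda>j t. \<beta> j * t)"
    show "\<forall>f. rat_solution \<alpha> f \<and> C \<alpha> \<longrightarrow> bt_reaches \<alpha> f \<beta> (\<lambda>j t. \<beta> j * t)"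
    proof (intro allI impI, elim conjE)
      fix f assume sol: "rat_solution \<alpha> f" and C: "C \<alpha>"
      have "rat_solution (s_par i \<alpha>) (s_fun i \<alpha> f)"
        by (rule s_fun_solution_if_nonzero[OF sol nz])
      then have "bt_reaches (s_par i \<alpha>) (s_fun i \<alpha> f) \<beta> (\<lambda>j t. \<beta> j * t)" using IH refl[OF C] by blast
      then show "bt_reaches \<alpha> f \<beta> (\<lambda>j t. \<beta> j * t)" by (rule bt_reaches_S[OF sol nz])
    qed
  qed
  then show ?thesis using sol C by blast
qed

theorem theorem0p1:
  fixes \<alpha> :: "5 \<Rightarrow> complex"
  assumes "(\<Sum>j\<in>UNIV. \<alpha> j) = 1"
  shows "((\<exists>f. rat_solution \<alpha> f) \<longleftrightarrow> (cond1 \<alpha> \<or> cond2 \<alpha> \<or> cond3 \<alpha>))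
    \<and> (\<forall>f g. rat_solution \<alpha> f \<and> rat_solution \<alpha> g \<longrightarrow> same_ratfun f g)
    \<and> (\<forall>f. rat_solution \<alpha> f \<and> cond1 \<alpha> \<longrightarrow>
          bt_reaches \<alpha> f (\<lambda>j. if j = 0 then 1 else 0) (\<lambda>j t. if j = 0 then t else 0))
    \<and> (\<forall>f. rat_solution \<alpha> f \<and> cond2 \<alpha> \<longrightarrow>
          bt_reaches \<alpha> f (\<lambda>j. if j \<in> {0,1,2} then 1/3 else 0)
                         (\<lambda>j t. if j \<in> {0,1,2} then t/3 else 0))
    \<and> (\<forall>f. rat_solution \<alpha> f \<and> cond3 \<alpha> \<longrightarrow>
          bt_reaches \<alpha> f (\<lambda>j. 1/5) (\<lambda>j t. t/5))"
proof (intro conjI)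
  show "(\<exists>f. rat_solution \<alpha> f) \<longleftrightarrow> (cond1 \<alpha> \<or> cond2 \<alpha> \<or> cond3 \<alpha>)"
    using cond_imp_solution[OF assms] solution_imp_cond[OF assms] by blast
  show "\<forall>f g. rat_solution \<alpha> f \<and> rat_solution \<alpha> g \<longrightarrow> same_ratfun f g"
    using solution_unique[OF assms] by blast
  show "\<forall>f. rat_solution \<alpha> f \<and> cond1 \<alpha> \<longrightarrow>
      bt_reaches \<alpha> f (\<lambda>j. if j = 0 then 1 else 0) (\<lambda>j t. if j = 0 then t else 0)"
  proof (intro allI impI, elim conjE)
    fix f assume sol: "rat_solution \<alpha> f" and c: "cond1 \<alpha>"
    let ?\<beta> = "\<lambda>j::5. if j = 0 then 1 else 0 :: complex"
    have "\<exists>i. \<forall>j. \<alpha> (i + j) = ?\<beta> j"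
      if al: "cond1 \<alpha>" "(\<Sum>j\<in>UNIV. \<alpha> j) = 1" "\<And>j. \<exists>x\<ge>0. \<alpha> j = complex_of_real x" for \<alpha>
    proof -
      obtain i where "(\<alpha> i, \<alpha> (i+1), \<alpha> (i+2), \<alpha> (i+3), \<alpha> (i+4)) = (1,0,0,0,0)"
        using alcove_cond1[OF al] by (elim exE)
      then show ?thesis unfolding all5 by (intro exI[of _ i]) simp
    qed
    from cond_reaches[where C = cond1, OF assms sol c this cond1_s_par]
    have "bt_reaches \<alpha> f ?\<beta> (\<lambda>j t. ?\<beta> j * t)" .
    moreover have "(\<lambda>j t. ?\<beta> j * t) = (\<lambda>j t. if j = 0 then t else 0)" by (simp add: fun_eq_iff)
    ultimately show "bt_reaches \<alpha> f ?\<beta> (\<lambda>j t. if j = 0 then t else 0)" by (simp only:)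
  qed
  show "\<forall>f. rat_solution \<alpha> f \<and> cond2 \<alpha> \<longrightarrow>
      bt_reaches \<alpha> f (\<lambda>j. if j \<in> {0,1,2} then 1/3 else 0) (\<lambda>j t. if j \<in> {0,1,2} then t/3 else 0)"
  proof (intro allI impI, elim conjE)
    fix f assume sol: "rat_solution \<alpha> f" and c: "cond2 \<alpha>"
    let ?\<beta> = "\<lambda>j::5. if j \<in> {0,1,2} then 1/3 else 0 :: complex"
    have "\<exists>i. \<forall>j. \<alpha> (i + j) = ?\<beta> j"
      if al: "cond2 \<alpha>" "(\<Sum>j\<in>UNIV. \<alpha> j) = 1" "\<And>j. \<exists>x\<ge>0. \<alpha> j = complex_of_real x" for \<alpha>
    proof -
      obtain i where "(\<alpha> i, \<alpha> (i+1), \<alpha> (i+2), \<alpha> (i+3), \<alpha> (i+4)) = (1/3,1/3,1/3,0,0)"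
        using alcove_cond2[OF al] by (elim exE)
      then show ?thesis unfolding all5 by (intro exI[of _ i]) simp
    qed
    from cond_reaches[where C = cond2, OF assms sol c this cond2_s_par]
    have "bt_reaches \<alpha> f ?\<beta> (\<lambda>j t. ?\<beta> j * t)" .
    moreover have "(\<lambda>j t. ?\<beta> j * t) = (\<lambda>j t. if j \<in> {0,1,2} then t/3 else 0)" by (simp add: fun_eq_iff)
    ultimately show "bt_reaches \<alpha> f ?\<beta> (\<lambda>j t. if j \<in> {0,1,2} then t/3 else 0)" by (simp only:)
  qed
  show "\<forall>f. rat_solution \<alpha> f \<and> cond3 \<alpha> \<longrightarrow> bt_reaches \<alpha> f (\<lambda>j. 1/5) (\<lambda>j t. t/5)"
  proof (intro allI impI, elim conjE)
    fix f assume sol: "rat_solution \<alpha> f" and c: "cond3 \<alpha>"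
    have ex: "\<exists>i. \<forall>j. \<alpha> (i + j) = 1/5"
      if al: "cond3 \<alpha>" "(\<Sum>j\<in>UNIV. \<alpha> j) = 1" "\<And>j. \<exists>x\<ge>0. \<alpha> j = complex_of_real x" for \<alpha>
    proof -
      obtain i where "(\<alpha> i, \<alpha> (i+1), \<alpha> (i+2), \<alpha> (i+3), \<alpha> (i+4)) = (1/5,1/5,1/5,1/5,1/5)"
        using alcove_cond3[OF al] by (elim exE)
      then show ?thesis unfolding all5 by (intro exI[of _ i]) simp
    qed
    have "bt_reaches \<alpha> f (\<lambda>j. 1/5) (\<lambda>j t. 1/5 * t)"
      by (rule cond_reaches[where C = cond3, OF assms sol c ex cond3_s_par])
    moreover have "(\<lambda>(j::5) t. 1/5 * t) = (\<lambda>j t. t/5 :: complex)" by (simp add: fun_eq_iff)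
    ultimately show "bt_reaches \<alpha> f (\<lambda>j. 1/5) (\<lambda>j t. t/5)" by (simp only:)
  qed
qed

end
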